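(* Let $\sigma,\zeta$ be the Weierstrass sigma and zeta functions for a lattice $2\omega_1\mathbb Z+2\omega_2\mathbb Z$ with $\mathrm{Im}(\omega_2/\omega_1)>0$. For every $n\ge1$ and $e\in\mathbb C$ with $\sigma(e)\ne0$, as an identity of meromorphic functions of $\alpha_1,\dots,\alpha_n$, $$\frac{\sigma\big(e-\sum_{j=1}^n\alpha_j\big)\prod_{1\le i<j\le n}\sigma(\alpha_i-\alpha_j)}{\sigma(e)\prod_{i=1}^n\sigma(\alpha_i)^{n-1}}=\det\big(\tilde\phi_i(\alpha_j)\big)_{1\le i,j\le n},\qquad\tilde\phi_i(\alpha_j)=\Big(\frac{\partial}{\partial v}+\zeta(\alpha_j)\Big)^{i-1}\Big(\frac{\sigma(v-\alpha_j)}{\sigma(v)}\Big)\Big|_{v=e}.$$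
   Context: $\sigma(u)$ is the Weierstrass sigma function of the lattice with periods $2\omega_1,2\omega_2$ and $\zeta(u)=\sigma'(u)/\sigma(u)$. *)

theory Defs
  imports "HOL-Analysis.Analysis" "Jordan_Normal_Form.Determinant"
begin

definition lattice_square :: "nat \<Rightarrow> (int \<times> int) set" where
  "lattice_square N = {(m, k). \<bar>m\<bar> \<le> int N \<and> \<bar>k\<bar> \<le> int N \<and> (m, k) \<noteq> (0, 0)}"

definition lattice_pt :: "complex \<Rightarrow> complex \<Rightarrow> int \<times> int \<Rightarrow> complex" where
  "lattice_pt w1 w2 p = 2 * of_int (fst p) * w1 + 2 * of_int (snd p) * w2"

text \<open>Weierstrass sigma function via its (absolutely convergent) Weierstrass product,
  taken as the limit of the partial products over expanding squares.\<close>
definition wsigma :: "complex \<Rightarrow> complex \<Rightarrow> complex \<Rightarrow> complex" where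
  "wsigma w1 w2 u = lim (\<lambda>N. u * (\<Prod>p\<in>lattice_square N.
      (let w = lattice_pt w1 w2 p in (1 - u / w) * exp (u / w + u\<^sup>2 / (2 * w\<^sup>2)))))"

definition wzeta :: "complex \<Rightarrow> complex \<Rightarrow> complex \<Rightarrow> complex" where
  "wzeta w1 w2 u = deriv (wsigma w1 w2) u / wsigma w1 w2 u"

fun shifted_deriv_pow :: "complex \<Rightarrow> nat \<Rightarrow> (complex \<Rightarrow> complex) \<Rightarrow> complex \<Rightarrow> complex" where
  "shifted_deriv_pow c 0 f = f"
| "shifted_deriv_pow c (Suc k) f =
     (\<lambda>v. deriv (shifted_deriv_pow c k f) v + c * shifted_deriv_pow c k f v)"

text \<open>phi~_i(alpha) with 0-based index i (i.e. exponent i instead of i-1).\<close>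
definition phi_tilde :: "complex \<Rightarrow> complex \<Rightarrow> complex \<Rightarrow> nat \<Rightarrow> complex \<Rightarrow> complex" where
  "phi_tilde w1 w2 e i a =
     shifted_deriv_pow (wzeta w1 w2 a) i (\<lambda>v. wsigma w1 w2 (v - a) / wsigma w1 w2 v) e"

end

theory Submission
  imports Defs "HOL-Complex_Analysis.Complex_Analysis"
begin

text \<open>Induction on \<open>n\<close>, regarding the determinant as a function of its last variable \<open>z\<close>. All rows
  pick up the same factor under a lattice shift of \<open>z\<close>, so after multiplication by \<open>\<sigma> z ^ n\<close> and
  division by \<open>\<Prod>j. \<sigma> (\<alpha> j - z)\<close> one has an entire function with the multipliers of
  \<open>\<sigma> (e - (\<Sum>j. \<alpha> j) - z)\<close>; such a function is a constant multiple of it. The constant is read off at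
  \<open>z = 0\<close>, where only the last row survives and leaves the determinant of size \<open>n - 1\<close>. This needs
  \<open>\<sigma> (e - (\<Sum>j. \<alpha> j)) \<noteq> 0\<close>; the remaining values of \<open>e\<close> follow by continuity.\<close>

section \<open>Entire functions\<close>

text \<open>The rows share a multiplier because two effects cancel: a lattice shift of
  \<open>z\<close> lowers \<open>wzeta\<close> by a constant \<open>a\<close>, and it multiplies
  \<open>\<sigma> (v - z) / \<sigma> v\<close> by a multiple of \<open>exp (a * v)\<close>, which
  turns the operator with the lowered constant back into the old one. The power
  \<open>\<sigma> z ^ n\<close> is dictated by the poles: row \<open>i\<close>, counted from 0,
  contains \<open>wzeta z ^ i\<close>, so \<open>n\<close> is the highest order. The analytic
  obstacle is that \<open>\<sigma>\<close> is only given as a limit of products over squares. A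
  shift by a period does not preserve a square but trades one boundary column for another. The
  quasi-period is a limit point of the exponents left over by this exchange, and on it rest both the
  fact that lattice points are simple zeros and the elliptic function arguments.\<close>

lemma entire_compose:
  "g holomorphic_on UNIV \<Longrightarrow> f holomorphic_on A \<Longrightarrow> (\<lambda>z. g (f z)) holomorphic_on A"
  using holomorphic_on_compose_gen[of f A g UNIV] by (simp add: o_def)

lemma entire_shift: "g holomorphic_on UNIV \<Longrightarrow> (\<lambda>z. g (z + a)) holomorphic_on UNIV"
  by (rule entire_compose) (auto intro!: holomorphic_intros)

lemma entire_imp_isCont: "f holomorphic_on UNIV \<Longrightarrow> isCont f z"
  using holomorphic_on_imp_continuous_on[of f UNIV] continuous_on_eq_continuous_at[of UNIV f]
  by simp

lemma isCont_nonzero_neighbourhood: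
  fixes f :: "complex \<Rightarrow> complex"
  assumes "isCont f a" "f a \<noteq> 0"
  obtains U where "open U" "a \<in> U" "\<And>z. z \<in> U \<Longrightarrow> f z \<noteq> 0"
  using continuous_at_avoid[of a f 0] assms
  by (metis centre_in_ball mem_ball open_ball)

text \<open>Zeros of \<open>s\<close> are isolated, so \<open>f\<close> and \<open>g\<close> agree
  on a punctured neighbourhood of every point and continuity fills the gap. This is the device for
  cancelling sigma factors.\<close>

lemma entire_eqI_off_zeros:
  assumes f: "f holomorphic_on UNIV" and g: "g holomorphic_on UNIV" and s: "s holomorphic_on UNIV"
    and nz: "s z0 \<noteq> 0" and eq: "\<And>z. s z \<noteq> 0 \<Longrightarrow> f z = g z"
  shows "f z = (g z :: complex)"
proof -
  have "\<forall>\<^sub>F w in at z. s w \<noteq> 0 \<and> w \<in> UNIV"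
    by (rule non_zero_neighbour_alt[OF s open_UNIV connected_UNIV UNIV_I UNIV_I nz])
  then have "\<forall>\<^sub>F w in at z. f w = g w"
    by eventually_elim (use eq in auto)
  moreover have "f \<midarrow>z\<rightarrow> f z" "g \<midarrow>z\<rightarrow> g z"
    using entire_imp_isCont f g by (auto simp: isCont_def)
  ultimately show ?thesis
    using tendsto_cong[of f g "at z"] LIM_unique by metis
qed

lemma entire_divide_simple_zeros:
  assumes f: "f holomorphic_on UNIV" and s: "s holomorphic_on UNIV"
    and simple: "\<And>z. s z = 0 \<Longrightarrow> deriv s z \<noteq> 0" and zero: "\<And>z. s z = 0 \<Longrightarrow> f z = 0"
  obtains q where "q holomorphic_on UNIV" "\<And>z. f z = q z * (s z :: complex)"
proof
  define q where "q z = (if s z = 0 then deriv f z / deriv s z else f z / s z)" for z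
  show "f z = q z * s z" for z
    using zero by (simp add: q_def)
  have "q field_differentiable at a" for a
  proof (cases "s a = 0")
    case True
    \<comment> \<open>Both \<open>f\<close> and \<open>s\<close> vanish at \<open>a\<close>, so near
      \<open>a\<close> the quotient is that of the difference quotients; the zero being simple gives
      \<open>T a \<noteq> 0\<close>.\<close>
    define F where "F = (\<lambda>z. if z = a then deriv f a else (f z - f a) / (z - a))"
    define T where "T = (\<lambda>z. if z = a then deriv s a else (s z - s a) / (z - a))"
    have F: "F holomorphic_on UNIV" and T: "T holomorphic_on UNIV"
      unfolding F_def T_def by (intro pole_lemma_open f s open_UNIV)+
    have "T a \<noteq> 0"
      using simple[OF True] by (simp add: T_def)
    then obtain U where U: "open U" "a \<in> U" "\<And>z. z \<in> U \<Longrightarrow> T z \<noteq> 0"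
      using isCont_nonzero_neighbourhood[OF entire_imp_isCont[OF T]] by blast
    have "q z = F z / T z" if "z \<in> U" for z
      using U(3)[OF that] True zero[OF True] by (auto simp: q_def F_def T_def)
    moreover have "(\<lambda>z. F z / T z) holomorphic_on U"
      using U F T by (intro holomorphic_intros) (auto intro: holomorphic_on_subset)
    ultimately have "q holomorphic_on U"
      by (simp cong: holomorphic_cong)
    then show ?thesis
      using U by (simp add: holomorphic_on_open field_differentiable_def)
  next
    case False
    obtain U where U: "open U" "a \<in> U" "\<And>z. z \<in> U \<Longrightarrow> s z \<noteq> 0"
      using isCont_nonzero_neighbourhood[OF entire_imp_isCont[OF s] False] by blast
    have "(\<lambda>z. f z / s z) holomorphic_on U"
      using U f s by (intro holomorphic_intros) (auto intro: holomorphic_on_subset)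
    then have "q holomorphic_on U"
      using U by (simp add: q_def cong: holomorphic_cong)
    then show ?thesis
      using U by (simp add: holomorphic_on_open field_differentiable_def)
  qed
  then show "q holomorphic_on UNIV"
    by (simp add: holomorphic_on_def)
qed

text \<open>Factors are divided out one at a time. Disjoint zero sets ensure that the quotient by
  the earlier factors still vanishes at the zeros of the next one.\<close>

lemma entire_divide_prod_simple_zeros:
  fixes f :: "complex \<Rightarrow> complex"
  assumes "finite I" and f: "f holomorphic_on UNIV"
    and "\<And>i. i \<in> I \<Longrightarrow> s i holomorphic_on UNIV"
    and "\<And>i z. i \<in> I \<Longrightarrow> s i z = 0 \<Longrightarrow> deriv (s i) z \<noteq> 0"
    and "\<And>i z. i \<in> I \<Longrightarrow> s i z = 0 \<Longrightarrow> f z = 0"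
    and "\<And>i j z. i \<in> I \<Longrightarrow> j \<in> I \<Longrightarrow> i \<noteq> j \<Longrightarrow> s i z = 0 \<Longrightarrow> s j z \<noteq> 0"
  shows "\<exists>q. q holomorphic_on UNIV \<and> (\<forall>z. f z = q z * (\<Prod>i\<in>I. s i z))"
  using assms(1,3-)
proof (induction I)
  case empty
  then show ?case using f by auto
next
  case (insert i I)
  have "\<exists>q. q holomorphic_on UNIV \<and> (\<forall>z. f z = q z * (\<Prod>i\<in>I. s i z))"
    by (rule insert.IH) (use insert.prems in blast)+
  then obtain q where q: "q holomorphic_on UNIV" "\<And>z. f z = q z * (\<Prod>i\<in>I. s i z)"
    by blast
  have "q z = 0" if "s i z = 0" for z
  proof -
    have "s j z \<noteq> 0" if "j \<in> I" for j
      using that insert.prems(4)[of i j z] insert.hyps \<open>s i z = 0\<close> by auto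
    moreover have "f z = 0"
      using insert.prems(3) that by blast
    ultimately show ?thesis
      using q(2)[of z] insert.hyps by simp
  qed
  then obtain q' where q': "q' holomorphic_on UNIV" "\<And>z. q z = q' z * s i z"
    using entire_divide_simple_zeros[OF q(1) insert.prems(1,2)] by blast
  then show ?case
    using q(2) insert.hyps by (intro exI[of _ q']) (simp add: mult_ac)
qed

lemma entire_prod_nonzero:
  assumes "finite I" "\<And>i. i \<in> I \<Longrightarrow> s i holomorphic_on UNIV" "\<And>i. i \<in> I \<Longrightarrow> \<exists>z. s i z \<noteq> 0"
  shows "\<exists>z. (\<Prod>i\<in>I. s i z) \<noteq> (0 :: complex)"
  using assms
proof (induction I)
  case (insert i I)
  obtain z where z: "s i z \<noteq> 0"
    using insert.prems(2) by blast
  obtain y where y: "(\<Prod>i\<in>I. s i y) \<noteq> 0"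
    using insert.IH insert.prems by blast
  have hol: "(\<lambda>z. \<Prod>i\<in>I. s i z) holomorphic_on UNIV"
    using insert.prems(1) by (intro holomorphic_on_prod) auto
  show ?case
  proof (rule ccontr)
    assume "\<nexists>z. (\<Prod>i\<in>insert i I. s i z) \<noteq> 0"
    then have "s i z * (\<Prod>i\<in>I. s i z) = 0" for z
      using insert.hyps by simp
    then have "(\<Prod>i\<in>I. s i y) = 0"
      using insert.prems(1) hol z
        entire_eqI_off_zeros[where f = "\<lambda>z. \<Prod>i\<in>I. s i z" and g = "\<lambda>_. 0"
            and s = "s i" and ?z0.0 = z and z = y] by auto
    then show False using y by simp
  qed
qed auto

section \<open>The Weierstrass product over expanding squares\<close>

lemma norm_prod_minus1_le:
  fixes a :: "'b \<Rightarrow> complex"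
  shows "norm ((\<Prod>p\<in>A. 1 + a p) - 1) \<le> (\<Prod>p\<in>A. 1 + norm (a p)) - 1"
proof (induction A rule: infinite_finite_induct)
  case (insert p A)
  have "norm ((\<Prod>p\<in>insert p A. 1 + a p) - 1) =
        norm ((1 + a p) * ((\<Prod>p\<in>A. 1 + a p) - 1) + a p)"
    using insert.hyps by (simp add: algebra_simps)
  also have "\<dots> \<le> (1 + norm (a p)) * norm ((\<Prod>p\<in>A. 1 + a p) - 1) + norm (a p)"
    using norm_triangle_ineq[of 1 "a p"]
    by (intro order.trans[OF norm_triangle_ineq] add_mono) (auto simp: norm_mult mult_right_mono)
  also have "\<dots> \<le> (1 + norm (a p)) * ((\<Prod>p\<in>A. 1 + norm (a p)) - 1) + norm (a p)"
    by (intro add_mono mult_left_mono insert.IH) auto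
  also have "\<dots> = (\<Prod>p\<in>insert p A. 1 + norm (a p)) - 1"
    using insert.hyps by (simp add: algebra_simps)
  finally show ?case .
qed auto

text \<open>The cubic bound decides convergence: a shell has \<open>8 * Suc n\<close> points at
  distance of order \<open>n\<close>, which leaves a summable error of order
  \<open>1 / n ^ 2\<close>.\<close>

lemma norm_prod_weierstrass_factor_minus1:
  assumes "\<And>p. p \<in> A \<Longrightarrow> norm (z p) \<le> 1 / 2"
    and "(\<Sum>p\<in>A. 3 * norm (z p) ^ 3) \<le> B" "B \<le> 1"
  shows "norm ((\<Prod>p\<in>A. weierstrass_factor 2 (z p)) - 1) \<le> 2 * B"
proof -
  define a where "a p = weierstrass_factor 2 (z p) - 1" for p
  have a: "norm (a p) \<le> 3 * norm (z p) ^ 3" if "p \<in> A" for p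
    using weierstrass_factor_bound[OF assms(1)[OF that], of 2]
    by (simp add: a_def eval_nat_numeral)
  have S: "(\<Sum>p\<in>A. norm (a p)) \<le> B"
    using sum_mono[of A "\<lambda>p. norm (a p)", OF a] assms(2) by simp
  then have B: "0 \<le> B"
    using sum_nonneg[of A "\<lambda>p. norm (a p)"] by simp
  have "norm ((\<Prod>p\<in>A. 1 + a p) - 1) \<le> (\<Prod>p\<in>A. 1 + norm (a p)) - 1"
    by (rule norm_prod_minus1_le)
  also have "\<dots> \<le> exp (\<Sum>p\<in>A. norm (a p)) - 1"
    using prod_le_exp_sum[of A "\<lambda>p. norm (a p)"] by simp
  also have "\<dots> \<le> exp B - 1"
    using S by simp
  also have "\<dots> \<le> B + B\<^sup>2"
    using exp_bound[OF B assms(3)] by simp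
  also have "\<dots> \<le> 2 * B"
    using B assms(3) mult_left_mono[of B 1 B] by (simp add: power2_eq_square)
  finally show ?thesis
    by (simp add: a_def)
qed

section \<open>Lattice squares and their shells\<close>

lemma lattice_square_eq: "lattice_square N = {- int N..int N} \<times> {- int N..int N} - {(0, 0)}"
  by (auto simp: lattice_square_def)

lemma finite_lattice_square [simp]: "finite (lattice_square N)"
  by (simp add: lattice_square_eq)

lemma card_lattice_square: "card (lattice_square N) = (2 * N + 1)\<^sup>2 - 1"
proof -
  have "card (lattice_square N) = card ({- int N..int N} \<times> {- int N..int N}) - 1"
    unfolding lattice_square_eq by (subst card_Diff_singleton) auto
  also have "card ({- int N..int N} \<times> {- int N..int N}) = (2 * N + 1)\<^sup>2"
    by (simp add: card_cartesian_product power2_eq_square nat_add_distrib nat_mult_distrib)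
  finally show ?thesis .
qed

lemma lattice_square_mono: "M \<le> N \<Longrightarrow> lattice_square M \<subseteq> lattice_square N"
  by (auto simp: lattice_square_def)

text \<open>Grouping by shells turns the product over the lattice into an ordinary infinite product
  in \<open>n\<close>, whose partial products are those over the squares.\<close>

definition lattice_shell :: "nat \<Rightarrow> (int \<times> int) set" where
  "lattice_shell n = lattice_square (Suc n) - lattice_square n"

lemma finite_lattice_shell [simp]: "finite (lattice_shell n)"
  by (simp add: lattice_shell_def)

lemma card_lattice_shell: "card (lattice_shell n) = 8 * Suc n"
  unfolding lattice_shell_def
  by (subst card_Diff_subset)
     (auto simp: card_lattice_square lattice_square_mono power2_eq_square algebra_simps)

lemma prod_lattice_shell:
  "(\<Prod>n<N. \<Prod>p\<in>lattice_shell n. g p) = (\<Prod>p\<in>lattice_square N. (g p :: complex))"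
proof (induction N)
  case 0
  have "lattice_square 0 = {}"
    by (auto simp: lattice_square_def)
  then show ?case by simp
next
  case (Suc N)
  have "lattice_square (Suc N) = lattice_square N \<union> lattice_shell N"
    using lattice_square_mono[of N "Suc N"] by (auto simp: lattice_shell_def)
  moreover have "lattice_square N \<inter> lattice_shell N = {}"
    by (auto simp: lattice_shell_def)
  ultimately show ?case
    using Suc by (simp add: prod.union_disjoint)
qed

definition wsigma_partial :: "complex \<Rightarrow> complex \<Rightarrow> nat \<Rightarrow> complex \<Rightarrow> complex" where
  "wsigma_partial w1 w2 N u =
     u * (\<Prod>p\<in>lattice_square N. weierstrass_factor 2 (u / lattice_pt w1 w2 p))"

lemma wsigma_eq_lim: "wsigma w1 w2 u = lim (\<lambda>N. wsigma_partial w1 w2 N u)"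
  by (simp add: wsigma_def wsigma_partial_def weierstrass_factor_def Let_def
      numeral_2_eq_2 power_divide mult_ac)

lemma lattice_pt_minus: "lattice_pt w1 w2 (- p) = - lattice_pt w1 w2 p"
  by (simp add: lattice_pt_def)

lemma wsigma_partial_odd: "wsigma_partial w1 w2 N (- u) = - wsigma_partial w1 w2 N u"
proof -
  have "(\<Prod>p\<in>lattice_square N. weierstrass_factor 2 (- u / lattice_pt w1 w2 p)) =
        (\<Prod>p\<in>lattice_square N. weierstrass_factor 2 (u / lattice_pt w1 w2 p))"
    by (rule prod.reindex_bij_witness[of _ uminus uminus])
       (auto simp: lattice_pt_minus lattice_square_def)
  then show ?thesis
    by (simp add: wsigma_partial_def)
qed

lemma wsigma_odd: "wsigma w1 w2 (- u) = - wsigma w1 w2 u" if "convergent (\<lambda>N. wsigma_partial w1 w2 N u)"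
  using that unfolding wsigma_eq_lim wsigma_partial_odd
  by (metis convergent_LIMSEQ_iff limI tendsto_minus)

text \<open>Squares are symmetric in the two periods; the law for \<open>w2\<close> can therefore be
  taken from the one for \<open>w1\<close>.\<close>

lemma wsigma_swap: "wsigma w1 w2 = wsigma w2 w1"
proof -
  have "(\<Prod>p\<in>lattice_square N. weierstrass_factor 2 (u / lattice_pt w1 w2 p)) =
        (\<Prod>p\<in>lattice_square N. weierstrass_factor 2 (u / lattice_pt w2 w1 p))" for N u
    by (rule prod.reindex_bij_witness[of _ prod.swap prod.swap])
       (auto simp: lattice_pt_def lattice_square_def add_ac)
  then show ?thesis
    by (simp add: wsigma_eq_lim wsigma_partial_def fun_eq_iff)
qed

text \<open>The condition is symmetric in the periods, so the locale can be interpreted with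
  \<open>w1\<close> and \<open>w2\<close> exchanged; a sign condition would not survive
  that.\<close>

locale period_lattice =
  fixes w1 w2 :: complex
  assumes Im_nz: "Im (w2 / w1) \<noteq> 0"
begin

lemma w1_nz: "w1 \<noteq> 0"
  using Im_nz by auto

text \<open>After division by \<open>w1\<close> the imaginary part bounds \<open>y\<close>, and
  subtracting \<open>y * t\<close> then bounds \<open>x\<close>; \<open>K\<close> is the sum of the
  two constants. Both the independence of the periods and the growth of lattice points come from
  this bound.\<close>

lemma norm_real_combination_ge:
  obtains c where "c > 0" "\<And>x y. c * max \<bar>x\<bar> \<bar>y\<bar> \<le> norm (of_real x * w1 + of_real y * w2)"
proof
  define t where "t = w2 / w1"
  define K where "K = (1 + norm t) / \<bar>Im t\<bar> + 1"
  have Im: "\<bar>Im t\<bar> > 0" using Im_nz by (simp add: t_def)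
  have K: "K > 0" unfolding K_def using Im by (intro add_nonneg_pos) auto
  show "norm w1 / K > 0" using K w1_nz by simp
  show "norm w1 / K * max \<bar>x\<bar> \<bar>y\<bar> \<le> norm (of_real x * w1 + of_real y * w2)" for x y
  proof -
    define z where "z = of_real x + of_real y * t"
    have eq: "norm (of_real x * w1 + of_real y * w2) = norm w1 * norm z"
      using w1_nz by (simp add: z_def t_def norm_mult[symmetric] algebra_simps)
    have "\<bar>y\<bar> * \<bar>Im t\<bar> \<le> norm z"
      using abs_Im_le_cmod[of z] by (simp add: z_def abs_mult)
    then have y: "\<bar>y\<bar> \<le> norm z / \<bar>Im t\<bar>"
      using Im by (simp add: field_simps)
    have "of_real x = z - of_real y * t"
      by (simp add: z_def)
    then have "\<bar>x\<bar> \<le> norm z + \<bar>y\<bar> * norm t"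
      using norm_triangle_ineq4[of z "of_real y * t"] by (metis norm_mult norm_of_real)
    also have "\<dots> \<le> norm z + norm z / \<bar>Im t\<bar> * norm t"
      using y by (intro add_left_mono mult_right_mono) auto
    finally have "\<bar>x\<bar> \<le> norm z + norm z / \<bar>Im t\<bar> * norm t" .
    moreover have "0 \<le> norm z / \<bar>Im t\<bar> * norm t" "0 \<le> norm z / \<bar>Im t\<bar>" by auto
    moreover have "K * norm z = norm z + norm z / \<bar>Im t\<bar> * norm t + norm z / \<bar>Im t\<bar>"
      by (simp add: K_def algebra_simps add_divide_distrib)
    ultimately have "max \<bar>x\<bar> \<bar>y\<bar> \<le> K * norm z"
      using y by (smt (verit, best) norm_ge_zero)
    then have "norm w1 * max \<bar>x\<bar> \<bar>y\<bar> \<le> norm w1 * (K * norm z)"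
      by (rule mult_left_mono) auto
    then show ?thesis
      unfolding eq using K by (simp add: field_simps)
  qed
qed

lemma norm_lattice_pt_shell_ge:
  obtains d where "d > 0"
    "\<And>n p. p \<in> lattice_shell n \<Longrightarrow> d * real (Suc n) \<le> norm (lattice_pt w1 w2 p)"
proof -
  obtain c where c: "c > 0"
    "\<And>x y. c * max \<bar>x\<bar> \<bar>y\<bar> \<le> norm (of_real x * w1 + of_real y * w2)"
    using norm_real_combination_ge by blast
  show ?thesis
  proof (rule that[of "2 * c"])
    fix n p assume p: "p \<in> lattice_shell n"
    obtain m k where mk: "p = (m, k)" by force
    have "int (Suc n) \<le> max \<bar>m\<bar> \<bar>k\<bar>"
      using p by (auto simp: mk lattice_shell_def lattice_square_def)
    then have "real_of_int (int (Suc n)) \<le> real_of_int (max \<bar>m\<bar> \<bar>k\<bar>)"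
      by (rule of_int_le_iff[THEN iffD2])
    then have "2 * real (Suc n) \<le> max \<bar>2 * real_of_int m\<bar> \<bar>2 * real_of_int k\<bar>"
      by (simp add: abs_mult)
    then have "c * (2 * real (Suc n)) \<le> c * max \<bar>2 * real_of_int m\<bar> \<bar>2 * real_of_int k\<bar>"
      using c(1) by (intro mult_left_mono) auto
    also have "\<dots> \<le> norm (lattice_pt w1 w2 p)"
      using c(2)[of "2 * real_of_int m" "2 * real_of_int k"] by (simp add: mk lattice_pt_def)
    finally show "2 * c * real (Suc n) \<le> norm (lattice_pt w1 w2 p)"
      by (simp add: algebra_simps)
  qed (use c in auto)
qed

section \<open>Convergence of the lattice product and holomorphy of sigma\<close>

definition shell_prod :: "nat \<Rightarrow> complex \<Rightarrow> complex" where
  "shell_prod n u = (\<Prod>p\<in>lattice_shell n. weierstrass_factor 2 (u / lattice_pt w1 w2 p))"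

definition lattice_prod :: "complex \<Rightarrow> complex" where
  "lattice_prod u = prodinf (\<lambda>n. shell_prod n u)"

lemma shell_prod_eq: "(\<Prod>n<N. shell_prod n u) =
    (\<Prod>p\<in>lattice_square N. weierstrass_factor 2 (u / lattice_pt w1 w2 p))"
  by (simp add: shell_prod_def prod_lattice_shell)

lemma real_combination_eq_0D:
  assumes "of_real x * w1 + of_real y * w2 = 0"
  shows "x = 0 \<and> y = 0"
proof -
  obtain c where c: "c > 0"
    "\<And>x y. c * max \<bar>x\<bar> \<bar>y\<bar> \<le> norm (of_real x * w1 + of_real y * w2)"
    using norm_real_combination_ge by blast
  have "c * max \<bar>x\<bar> \<bar>y\<bar> \<le> 0"
    using c(2)[of x y] assms by simp
  then have "max \<bar>x\<bar> \<bar>y\<bar> \<le> 0"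
    using c(1) by (simp add: mult_le_0_iff)
  then show ?thesis by auto
qed

lemma lattice_pt_eq_0_iff: "lattice_pt w1 w2 p = 0 \<longleftrightarrow> p = (0, 0)"
  using real_combination_eq_0D[of "2 * of_int (fst p)" "2 * of_int (snd p)"]
  by (auto simp: lattice_pt_def prod_eq_iff)

lemma shell_prod_bound:
  assumes "R > 0"
  obtains C where "\<forall>\<^sub>F n in sequentially. \<forall>u\<in>cball 0 R.
    norm (shell_prod n u - 1) \<le> C * inverse (real (Suc n) ^ 2)"
proof -
  obtain d where d: "d > 0"
    "\<And>n p. p \<in> lattice_shell n \<Longrightarrow> d * real (Suc n) \<le> norm (lattice_pt w1 w2 p)"
    using norm_lattice_pt_shell_ge by blast
  \<comment> \<open>24 is 8, from the number of points in a shell, times 3, from the factor bound.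
    The threshold \<open>2 * R / d + C\<close> below makes the arguments at most
    \<open>1 / 2\<close> and the total error at most 1.\<close>
  define C where "C = 24 * (R / d) ^ 3"
  have C: "C > 0" using assms d by (simp add: C_def)
  have "\<forall>\<^sub>F n in sequentially. real n \<ge> 2 * R / d + C"
    using filterlim_real_sequentially filterlim_at_top by blast
  then have "\<forall>\<^sub>F n in sequentially. \<forall>u\<in>cball 0 R.
      norm (shell_prod n u - 1) \<le> 2 * C * inverse (real (Suc n) ^ 2)"
  proof (eventually_elim, intro ballI)
    fix n and u :: complex assume n: "real n \<ge> 2 * R / d + C" and u: "u \<in> cball 0 R"
    have "0 \<le> 2 * R / d"
      using assms d(1) by simp
    then have n1: "real (Suc n) \<ge> 2 * R / d" and n2: "real (Suc n) \<ge> C"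
      using n C by linarith+
    have le: "norm (u / lattice_pt w1 w2 p) \<le> R / (d * real (Suc n))" if "p \<in> lattice_shell n" for p
      unfolding norm_divide
      using d u that assms by (intro frac_le) auto
    have "norm (shell_prod n u - 1) \<le> 2 * (C * inverse (real (Suc n) ^ 2))"
      unfolding shell_prod_def
    proof (rule norm_prod_weierstrass_factor_minus1)
      show "norm (u / lattice_pt w1 w2 p) \<le> 1 / 2" if "p \<in> lattice_shell n" for p
      proof -
        have "R / (d * real (Suc n)) \<le> 1 / 2"
          using n1 d(1) by (simp add: field_simps del: of_nat_Suc)
        then show ?thesis
          using le[OF that] by linarith
      qed
      have "(\<Sum>p\<in>lattice_shell n. 3 * norm (u / lattice_pt w1 w2 p) ^ 3) \<le>
            (\<Sum>p\<in>lattice_shell n. 3 * (R / (d * real (Suc n))) ^ 3)"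
        by (intro sum_mono mult_left_mono power_mono le) auto
      also have "\<dots> = 8 * real (Suc n) * (3 * (R / (d * real (Suc n))) ^ 3)"
        by (simp add: card_lattice_shell of_nat_mult del: of_nat_Suc mult_Suc_right)
      also have "\<dots> = C * inverse (real (Suc n) ^ 2)"
      proof -
        have "8 * y * (3 * (R / (d * y)) ^ 3) = C * inverse (y ^ 2)" if "y > 0" for y
          using that d(1) by (simp add: C_def field_simps power2_eq_square power3_eq_cube)
        then show ?thesis by (simp del: of_nat_Suc)
      qed
      finally show "(\<Sum>p\<in>lattice_shell n. 3 * norm (u / lattice_pt w1 w2 p) ^ 3)
        \<le> C * inverse (real (Suc n) ^ 2)" .
      have "C \<le> real (Suc n) ^ 2"
        using n2 by (smt (verit) of_nat_Suc of_nat_0_le_iff self_le_power zero_less_numeral)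
      then show "C * inverse (real (Suc n) ^ 2) \<le> 1"
        by (simp add: field_simps del: of_nat_Suc)
    qed
    then show "norm (shell_prod n u - 1) \<le> 2 * C * inverse (real (Suc n) ^ 2)"
      by simp
  qed
  then show ?thesis by (rule that)
qed

lemma summable_inverse_squares: "summable (\<lambda>n. C * inverse (real (Suc n) ^ 2))"
  using inverse_power_summable[of 2, where 'a=real]
  by (intro summable_mult) (subst summable_Suc_iff, simp)

lemma shell_prod_holomorphic [holomorphic_intros]: "shell_prod n holomorphic_on A"
  unfolding shell_prod_def
  by (intro holomorphic_intros) (auto simp: lattice_pt_eq_0_iff lattice_shell_def lattice_square_def)

lemma convergent_shell_prod: "convergent_prod (\<lambda>n. shell_prod n u)"
proof (rule abs_convergent_prod_imp_convergent_prod, unfold abs_convergent_prod_conv_summable)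
  obtain C where C: "\<forall>\<^sub>F n in sequentially. \<forall>u\<in>cball 0 (norm u + 1).
    norm (shell_prod n u - 1) \<le> C * inverse (real (Suc n) ^ 2)"
    using shell_prod_bound[of "norm u + 1"] by (auto simp: add_nonneg_pos)
  show "summable (\<lambda>n. norm (shell_prod n u - 1))"
    by (rule summable_comparison_test_ev[OF _ summable_inverse_squares[of C]])
       (use C in eventually_elim, auto)
qed

lemma lattice_square_prod_LIMSEQ:
  "(\<lambda>N. \<Prod>n<N. shell_prod n u) \<longlonglongrightarrow> lattice_prod u"
  using convergent_prod_LIMSEQ[OF convergent_shell_prod[of u]]
  unfolding lattice_prod_def LIMSEQ_lessThan_iff_atMost .

lemma lattice_prod_uniform_limit:
  assumes "R > 0"
  shows "uniform_limit (cball 0 R) (\<lambda>N u. \<Prod>n<N. shell_prod n u) lattice_prod sequentially"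
proof -
  obtain C where C: "\<forall>\<^sub>F n in sequentially. \<forall>u\<in>cball 0 R.
    norm (shell_prod n u - 1) \<le> C * inverse (real (Suc n) ^ 2)"
    using shell_prod_bound[OF assms] by blast
  have "uniformly_convergent_on (cball 0 R) (\<lambda>N u. \<Sum>n<N. norm (shell_prod n u - 1))"
    by (rule Weierstrass_m_test'_ev[OF _ summable_inverse_squares[of C]]) (use C in simp)
  then have "uniformly_convergent_on (cball 0 R) (\<lambda>N u. \<Prod>n<N. shell_prod n u)"
    by (intro uniformly_convergent_on_prod' holomorphic_on_imp_continuous_on holomorphic_intros) auto
  then obtain g where g: "uniform_limit (cball 0 R) (\<lambda>N u. \<Prod>n<N. shell_prod n u) g sequentially"
    by (auto simp: uniformly_convergent_on_def)
  have "g u = lattice_prod u" if "u \<in> cball 0 R" for u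
    using LIMSEQ_unique[OF tendsto_uniform_limitI[OF g that] lattice_square_prod_LIMSEQ[of u]] .
  then show ?thesis
    using g uniform_limit_cong'[of "cball 0 R" "\<lambda>N u. \<Prod>n<N. shell_prod n u"
        "\<lambda>N u. \<Prod>n<N. shell_prod n u" g lattice_prod sequentially] by simp
qed

lemma lattice_prod_holomorphic: "lattice_prod holomorphic_on UNIV"
proof (rule holomorphic_uniform_sequence)
  fix z :: complex
  have "uniform_limit (cball z 1) (\<lambda>N u. \<Prod>n<N. shell_prod n u) lattice_prod sequentially"
    by (rule uniform_limit_on_subset[OF lattice_prod_uniform_limit[of "norm z + 1"]])
       (simp_all add: add_nonneg_pos cball_subset_cball_iff)
  then show "\<exists>d>0. cball z d \<subseteq> UNIV \<and>
      uniform_limit (cball z d) (\<lambda>N u. \<Prod>n<N. shell_prod n u) lattice_prod sequentially"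
    by (intro exI[of _ 1]) auto
qed (auto intro!: holomorphic_intros)

lemma wsigma_partial_LIMSEQ: "(\<lambda>N. wsigma_partial w1 w2 N u) \<longlonglongrightarrow> u * lattice_prod u"
  unfolding wsigma_partial_def shell_prod_eq[symmetric]
  by (intro tendsto_intros lattice_square_prod_LIMSEQ)

lemma wsigma_eq: "wsigma w1 w2 u = u * lattice_prod u"
  unfolding wsigma_eq_lim by (rule limI[OF wsigma_partial_LIMSEQ])

lemma wsigma_LIMSEQ: "(\<lambda>N. wsigma_partial w1 w2 N u) \<longlonglongrightarrow> wsigma w1 w2 u"
  using wsigma_partial_LIMSEQ by (simp add: wsigma_eq)

lemma wsigma_entire: "wsigma w1 w2 holomorphic_on UNIV"
  unfolding wsigma_eq[abs_def] by (intro holomorphic_intros lattice_prod_holomorphic)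

lemma wsigma_holomorphic [holomorphic_intros]:
  "f holomorphic_on A \<Longrightarrow> (\<lambda>z. wsigma w1 w2 (f z)) holomorphic_on A"
  by (rule entire_compose[OF wsigma_entire])

lemma wsigma_DERIV: "(wsigma w1 w2 has_field_derivative deriv (wsigma w1 w2) u) (at u)"
  using wsigma_entire holomorphic_derivI by blast

lemma wsigma_minus: "wsigma w1 w2 (- u) = - wsigma w1 w2 u"
  by (rule wsigma_odd) (use wsigma_LIMSEQ in \<open>auto simp: convergent_def\<close>)

lemma wsigma_0 [simp]: "wsigma w1 w2 0 = 0"
  by (simp add: wsigma_eq)

lemma lattice_prod_0: "lattice_prod 0 = 1"
  by (simp add: lattice_prod_def shell_prod_def)

lemma deriv_wsigma_0 [simp]: "deriv (wsigma w1 w2) 0 = 1"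
proof (rule DERIV_imp_deriv)
  have "((\<lambda>u. u * lattice_prod u) has_field_derivative 0 * deriv lattice_prod 0 + 1 * lattice_prod 0) (at 0)"
    using holomorphic_derivI[OF lattice_prod_holomorphic open_UNIV UNIV_I, of 0]
    by (auto intro!: derivative_eq_intros)
  then show "(wsigma w1 w2 has_field_derivative 1) (at 0)"
    by (simp add: lattice_prod_0 wsigma_eq[abs_def])
qed

text \<open>A convergent infinite product without vanishing factors is nonzero. That lattice points
  are zeros is obtained from the shift laws instead.\<close>

lemma wsigma_nz:
  assumes "u \<notin> range (lattice_pt w1 w2)"
  shows "wsigma w1 w2 u \<noteq> 0"
proof -
  have "u \<noteq> 0"
    using assms lattice_pt_eq_0_iff by (metis rangeI)
  moreover have "lattice_prod u \<noteq> 0"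
    unfolding lattice_prod_def
  proof (rule prodinf_nonzero[OF convergent_shell_prod])
    fix n show "shell_prod n u \<noteq> 0"
      using assms unfolding shell_prod_def
      by (auto simp: divide_eq_1_iff)
  qed
  ultimately show ?thesis by (simp add: wsigma_eq)
qed

end

section \<open>Quasi-periodicity of the sigma function\<close>

text \<open>Separates the polynomial part, on which a period shift acts by reindexing, from the
  convergence factors.\<close>

lemma prod_weierstrass_factor_2:
  "(\<Prod>p\<in>A. weierstrass_factor 2 (z p)) =
     (\<Prod>p\<in>A. 1 - z p) * exp ((\<Sum>p\<in>A. z p) + (\<Sum>p\<in>A. (z p)\<^sup>2) / 2)"
proof (induction A rule: infinite_finite_induct)
  case (insert x A)
  then show ?case
    by (simp add: weierstrass_factor_def numeral_2_eq_2 exp_add add_divide_distrib mult_ac)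
qed auto

lemma prod_int_interval_shift:
  fixes h :: "int \<Rightarrow> complex"
  shows "(\<Prod>m\<in>{- int N..int N}. h (m - 1)) * h (int N) = h (- int N - 1) * (\<Prod>m\<in>{- int N..int N}. h m)"
proof -
  have "(\<Prod>m\<in>{- int N..int N}. h (m - 1)) = (\<Prod>m\<in>{- int N - 1..int N - 1}. h m)"
    by (rule prod.reindex_bij_witness[of _ "\<lambda>m. m + 1" "\<lambda>m. m - 1"]) auto
  also have "\<dots> * h (int N) = (\<Prod>m\<in>insert (int N) {- int N - 1..int N - 1}. h m)"
    by simp
  also have "insert (int N) {- int N - 1..int N - 1} = insert (- int N - 1) {- int N..int N}"
    by auto
  finally show ?thesis by simp
qed

text \<open>A bounded exponential only bounds a real part from above; four directions recover the
  modulus.\<close>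

lemma norm_bounds_of_Re:
  fixes c :: complex
  assumes "r > 0" "Re (of_real r * c) \<le> B" "Re (- of_real r * c) \<le> B"
    "Re (of_real r * \<i> * c) \<le> B" "Re (- of_real r * \<i> * c) \<le> B"
  shows "norm c \<le> 2 * B / r"
proof -
  have "r * \<bar>Re c\<bar> \<le> B" "r * \<bar>Im c\<bar> \<le> B"
    using assms by (auto simp: abs_if)
  then have "r * norm c \<le> 2 * B"
    using mult_left_mono[OF cmod_le[of c], of r] assms(1) by (simp add: algebra_simps)
  then show ?thesis
    using assms(1) by (simp add: field_simps)
qed

context period_lattice
begin

text \<open>Midpoints between the boundary column \<open>m = N\<close> and the next one. In the
  centred variable \<open>v = u + w1\<close>, a shift by \<open>2 * w1\<close> removes the factors
  \<open>v - strip_pt N k\<close> and brings in \<open>v + strip_pt N (- k)\<close>.\<close>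

definition strip_pt :: "nat \<Rightarrow> int \<Rightarrow> complex" where
  "strip_pt N k = (2 * of_nat N + 1) * w1 + 2 * of_int k * w2"

text \<open>The convergence factors make this product tend to 1. Their linear exponent reappears in
  \<open>eta_partial\<close>; the quadratic one is even in \<open>v\<close> and cancels between
  \<open>v\<close> and \<open>- v\<close>.\<close>

definition strip_prod :: "nat \<Rightarrow> complex \<Rightarrow> complex" where
  "strip_prod N v = (\<Prod>k\<in>{- int N..int N}. weierstrass_factor 2 (v / strip_pt N k))"

text \<open>The quasi-period at level \<open>N\<close>: the first sum is the change of the quadratic
  convergence factors of sigma, the second compensates the linear exponents put into
  \<open>strip_prod N v\<close> and \<open>strip_prod N (- v)\<close>.\<close>

definition eta_partial :: "nat \<Rightarrow> complex" where
  "eta_partial N = 2 * w1 * (\<Sum>p\<in>lattice_square N. 1 / (lattice_pt w1 w2 p)\<^sup>2)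
     + 2 * (\<Sum>k\<in>{- int N..int N}. 1 / strip_pt N k)"

lemma strip_pt_nz: "strip_pt N k \<noteq> 0"
  using real_combination_eq_0D[of "2 * real N + 1" "2 * of_int k"]
  by (auto simp: strip_pt_def)

text \<open>There are \<open>2 * N + 1\<close> factors with arguments of order \<open>1 / N\<close>,
  so the cubic bound leaves an error of order \<open>1 / N ^ 2\<close>.\<close>

lemma strip_prod_LIMSEQ: "(\<lambda>N. strip_prod N v) \<longlonglongrightarrow> 1"
proof -
  obtain c where c: "c > 0"
    "\<And>x y. c * max \<bar>x\<bar> \<bar>y\<bar> \<le> norm (of_real x * w1 + of_real y * w2)"
    using norm_real_combination_ge by blast
  define y where "y N = 1 / (2 * real N + 1)" for N
  define x where "x N = norm v / c * y N" for N
  define B where "B N = 3 * (norm v / c) ^ 3 * (y N)\<^sup>2" for N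
  have le: "norm (v / strip_pt N k) \<le> x N" for N k
  proof -
    have "c * (2 * real N + 1) \<le> c * max \<bar>2 * real N + 1\<bar> \<bar>2 * real_of_int k\<bar>"
      using c(1) by (intro mult_left_mono) auto
    also have "\<dots> \<le> norm (strip_pt N k)"
      using c(2)[of "2 * real N + 1" "2 * real_of_int k"] by (simp add: strip_pt_def)
    finally show ?thesis
      using c(1) frac_le[of "norm v" "norm v" "c * (2 * real N + 1)" "norm (strip_pt N k)"]
      by (simp add: norm_divide x_def y_def)
  qed
  have y: "y \<longlonglongrightarrow> 0"
    unfolding y_def by real_asymp
  have x: "x \<longlonglongrightarrow> 0" and B: "B \<longlonglongrightarrow> 0"
    unfolding B_def x_def using c(1) by (auto intro!: tendsto_eq_intros y)
  have "\<forall>\<^sub>F N in sequentially. x N < 1 / 2" "\<forall>\<^sub>F N in sequentially. B N < 1"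
    using order_tendstoD(2)[OF x, of "1 / 2"] order_tendstoD(2)[OF B, of 1] by auto
  then have "\<forall>\<^sub>F N in sequentially. norm (strip_prod N v - 1) \<le> 2 * B N"
  proof eventually_elim
    case (elim N)
    show ?case unfolding strip_prod_def
    proof (rule norm_prod_weierstrass_factor_minus1)
      show "norm (v / strip_pt N k) \<le> 1 / 2" for k
        using le[of N k] elim by simp
      have "(\<Sum>k\<in>{- int N..int N}. 3 * norm (v / strip_pt N k) ^ 3) \<le>
            (\<Sum>k\<in>{- int N..int N}. 3 * x N ^ 3)"
        by (intro sum_mono mult_left_mono power_mono le) auto
      also have "\<dots> = (2 * real N + 1) * (3 * x N ^ 3)"
        by simp
      also have "\<dots> = B N"
      proof -
        have "M * (3 * (q * (1 / M)) ^ 3) = 3 * q ^ 3 * (1 / M)\<^sup>2" if "M > 0" for M q :: real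
          using that by (simp add: field_simps power2_eq_square power3_eq_cube)
        from this[of "2 * real N + 1" "norm v / c"] show ?thesis
          by (simp add: B_def x_def y_def)
      qed
      finally show "(\<Sum>k\<in>{- int N..int N}. 3 * norm (v / strip_pt N k) ^ 3) \<le> B N" .
    qed (use elim in simp)
  qed
  moreover have "(\<lambda>N. 2 * B N) \<longlonglongrightarrow> 0"
    using tendsto_mult_right_zero[OF B] .
  ultimately have "(\<lambda>N. strip_prod N v - 1) \<longlonglongrightarrow> 0"
    by (rule Lim_null_comparison)
  then show ?thesis
    by (simp add: LIM_zero_iff)
qed

text \<open>Each row loses one factor at one end and gains one at the other. The sign is
  \<open>(- 1) ^ (2 * N + 1)\<close>, from normalising the lost factors; it becomes the sign in the
  law of sigma.\<close>

lemma prod_lattice_box_shift: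
  fixes u v :: complex and N :: nat
  defines "F \<equiv> \<lambda>u. \<Prod>(k, m)\<in>{- int N..int N} \<times> {- int N..int N}. u - lattice_pt w1 w2 (m, k)"
  assumes v: "v = u + w1"
  shows "F (u + 2 * w1) * (\<Prod>k\<in>{- int N..int N}. 1 - v / strip_pt N k) =
         - (\<Prod>k\<in>{- int N..int N}. 1 + v / strip_pt N k) * F u"
proof -
  let ?I = "{- int N..int N}"
  have F: "F u = (\<Prod>k\<in>?I. \<Prod>m\<in>?I. u - lattice_pt w1 w2 (m, k))" for u
    unfolding F_def by (simp add: prod.cartesian_product)
  have "(\<Prod>m\<in>?I. u + 2 * w1 - lattice_pt w1 w2 (m, k)) * (v - strip_pt N k) =
        (v + strip_pt N (- k)) * (\<Prod>m\<in>?I. u - lattice_pt w1 w2 (m, k))" for k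
    using prod_int_interval_shift[where h = "\<lambda>m. u - lattice_pt w1 w2 (m, k)" and N = N]
    by (simp add: lattice_pt_def strip_pt_def v algebra_simps)
  then have "F (u + 2 * w1) * (\<Prod>k\<in>?I. v - strip_pt N k) =
        (\<Prod>k\<in>?I. v + strip_pt N (- k)) * F u"
    by (simp add: F prod.distrib[symmetric])
  also have "(\<Prod>k\<in>?I. v + strip_pt N (- k)) = (\<Prod>k\<in>?I. v + strip_pt N k)"
    by (rule prod.reindex_bij_witness[of _ uminus uminus]) auto
  also have "\<dots> = (\<Prod>k\<in>?I. strip_pt N k) * (\<Prod>k\<in>?I. 1 + v / strip_pt N k)"
    unfolding prod.distrib[symmetric]
    by (rule prod.cong) (use strip_pt_nz in \<open>auto simp: distrib_left\<close>)
  also have "(\<Prod>k\<in>?I. v - strip_pt N k) = (\<Prod>k\<in>?I. (- 1) * (strip_pt N k * (1 - v / strip_pt N k)))"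
    using strip_pt_nz by (intro prod.cong) (auto simp: field_simps)
  also have "\<dots> = - ((\<Prod>k\<in>?I. strip_pt N k) * (\<Prod>k\<in>?I. 1 - v / strip_pt N k))"
    unfolding prod.distrib by (simp add: nat_add_distrib nat_mult_distrib)
  finally have "(\<Prod>k\<in>?I. strip_pt N k) * (F (u + 2 * w1) * (\<Prod>k\<in>?I. 1 - v / strip_pt N k)) =
     (\<Prod>k\<in>?I. strip_pt N k) * (- (\<Prod>k\<in>?I. 1 + v / strip_pt N k) * F u)"
    by (simp add: algebra_simps minus_equation_iff)
  then show ?thesis
    using strip_pt_nz by (simp only: mult_cancel_left) auto
qed

text \<open>An exact law at finite level, free of denominators. The linear convergence factors
  cancel over the symmetric square, and
  \<open>((u + 2 * w1)\<^sup>2 - u\<^sup>2) / 2 = 2 * w1 * v\<close> accounts for the quadratic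
  ones.\<close>

lemma wsigma_partial_shift:
  assumes v: "v = u + w1"
  shows "wsigma_partial w1 w2 N (u + 2 * w1) * strip_prod N v =
         - exp (v * eta_partial N) * wsigma_partial w1 w2 N u * strip_prod N (- v)"
proof -
  let ?I = "{- int N..int N}" and ?S = "lattice_square N" and ?pt = "lattice_pt w1 w2"
  define F where "F u = (\<Prod>(k, m)\<in>?I \<times> ?I. u - ?pt (m, k))" for u
  define s where "s = (\<Sum>p\<in>?S. 1 / (?pt p)\<^sup>2)"
  define K where "K = (\<Prod>p\<in>?S. - 1 / ?pt p)"
  define t where "t = (\<Sum>k\<in>?I. 1 / strip_pt N k)"
  define r where "r = (\<Sum>k\<in>?I. 1 / (strip_pt N k)\<^sup>2)"
  have s0: "(\<Sum>p\<in>?S. u / ?pt p) = 0" for u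
  proof -
    have "(\<Sum>p\<in>?S. u / ?pt p) = (\<Sum>p\<in>?S. - (u / ?pt p))"
      by (rule sum.reindex_bij_witness[of _ uminus uminus])
         (auto simp: lattice_pt_minus lattice_square_def)
    then show ?thesis
      by (simp add: sum_negf)
  qed
  have F: "F u = u * (\<Prod>p\<in>?S. u - ?pt p)" for u
  proof -
    have "F u = (\<Prod>p\<in>?I \<times> ?I. u - ?pt p)"
      unfolding F_def by (rule prod.reindex_bij_witness[of _ prod.swap prod.swap]) auto
    also have "\<dots> = (\<Prod>p\<in>insert (0, 0) ?S. u - ?pt p)"
      by (rule prod.cong) (auto simp: lattice_square_def)
    also have "\<dots> = (u - ?pt (0, 0)) * (\<Prod>p\<in>?S. u - ?pt p)"
      by (rule prod.insert) (simp, simp add: lattice_square_def)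
    finally show ?thesis
      by (simp add: lattice_pt_def)
  qed
  have P: "wsigma_partial w1 w2 N u = exp (u\<^sup>2 * s / 2) * K * F u" for u
  proof -
    have "(\<Prod>p\<in>?S. 1 - u / ?pt p) = (\<Prod>p\<in>?S. (- 1 / ?pt p) * (u - ?pt p))"
      by (rule prod.cong)
         (auto simp: field_simps lattice_pt_eq_0_iff lattice_square_def)
    then have "(\<Prod>p\<in>?S. 1 - u / ?pt p) = K * (\<Prod>p\<in>?S. u - ?pt p)"
      by (simp only: prod.distrib K_def)
    moreover have "(\<Sum>p\<in>?S. (u / ?pt p)\<^sup>2) = u\<^sup>2 * s"
      by (simp add: s_def sum_distrib_left power_divide)
    ultimately show ?thesis
      by (simp add: wsigma_partial_def prod_weierstrass_factor_2 s0 F)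
  qed
  have Q: "strip_prod N v = (\<Prod>k\<in>?I. 1 - v / strip_pt N k) * exp (v * t + v\<^sup>2 * r / 2)" for v
    by (simp add: strip_prod_def prod_weierstrass_factor_2 t_def r_def sum_distrib_left power_divide)
  have shift: "F (u + 2 * w1) * (\<Prod>k\<in>?I. 1 - v / strip_pt N k) =
         - (\<Prod>k\<in>?I. 1 + v / strip_pt N k) * F u"
    unfolding F_def by (rule prod_lattice_box_shift[OF v])
  have "eta_partial N = 2 * w1 * s + 2 * t"
    by (simp add: eta_partial_def s_def t_def)
  then have eta: "v * eta_partial N + u\<^sup>2 * s / 2 + (- v * t + v\<^sup>2 * r / 2) =
      (u + 2 * w1)\<^sup>2 * s / 2 + (v * t + v\<^sup>2 * r / 2)"
    by (simp add: v power2_eq_square field_simps)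
  have "wsigma_partial w1 w2 N (u + 2 * w1) * strip_prod N v =
    exp ((u + 2 * w1)\<^sup>2 * s / 2 + (v * t + v\<^sup>2 * r / 2)) * K *
    (F (u + 2 * w1) * (\<Prod>k\<in>?I. 1 - v / strip_pt N k))"
    by (simp add: P Q exp_add)
  also have "\<dots> = - exp (v * eta_partial N) * wsigma_partial w1 w2 N u * strip_prod N (- v)"
    unfolding shift eta[symmetric] by (simp add: P Q exp_add)
  finally show ?thesis .
qed

section \<open>Boundedness of the exponents and the quasi-periods\<close>

lemma odd_half_period_nz:
  assumes "odd m \<or> odd k"
  shows "wsigma w1 w2 (of_int m * w1 + of_int k * w2) \<noteq> 0"
proof (rule wsigma_nz, rule notI)
  assume "of_int m * w1 + of_int k * w2 \<in> range (lattice_pt w1 w2)"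
  then obtain a b :: int where "of_int m * w1 + of_int k * w2 = 2 * of_int a * w1 + 2 * of_int b * w2"
    by (auto simp: lattice_pt_def)
  then have "of_real (of_int (m - 2 * a)) * w1 + of_real (of_int (k - 2 * b)) * w2 = 0"
    by (simp add: algebra_simps)
  then have "real_of_int (m - 2 * a) = 0 \<and> real_of_int (k - 2 * b) = 0"
    by (rule real_combination_eq_0D)
  then show False
    using assms by (simp del: of_int_diff of_int_mult)
qed

text \<open>The quasi-period is a subsequential limit of \<open>eta_partial\<close>, so boundedness of this sequence
  suffices and its convergence is not needed.\<close>

lemma Re_eta_partial_bounded_above:
  assumes "wsigma w1 w2 (v - w1) \<noteq> 0"
  obtains B where "\<And>N. Re (v * eta_partial N) \<le> B"
proof -
  \<comment> \<open>The finite law at \<open>u = v - w1\<close>, solved for the exponential.\<close>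
  define D where "D N = - (wsigma_partial w1 w2 N (v + w1) * strip_prod N v) /
      (wsigma_partial w1 w2 N (v - w1) * strip_prod N (- v))" for N
  have lim: "(\<lambda>N. wsigma_partial w1 w2 N (v - w1) * strip_prod N (- v)) \<longlonglongrightarrow> wsigma w1 w2 (v - w1) * 1"
    by (intro tendsto_intros wsigma_LIMSEQ strip_prod_LIMSEQ)
  then have "\<forall>\<^sub>F N in sequentially. wsigma_partial w1 w2 N (v - w1) * strip_prod N (- v) \<noteq> 0"
    using assms by (intro tendsto_imp_eventually_ne) auto
  then have ev: "\<forall>\<^sub>F N in sequentially. D N = exp (v * eta_partial N)"
  proof eventually_elim
    case (elim N)
    then show ?case
      using wsigma_partial_shift[of v "v - w1" N] by (simp add: D_def algebra_simps field_simps)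
  qed
  have "D \<longlonglongrightarrow> - (wsigma w1 w2 (v + w1) * 1) / (wsigma w1 w2 (v - w1) * 1)"
    unfolding D_def using assms by (intro tendsto_divide lim tendsto_intros wsigma_LIMSEQ strip_prod_LIMSEQ) auto
  then have "(\<lambda>N. exp (v * eta_partial N)) \<longlonglongrightarrow> - (wsigma w1 w2 (v + w1) * 1) / (wsigma w1 w2 (v - w1) * 1)"
    using tendsto_cong[OF ev] by blast
  then have "Bseq (\<lambda>N. exp (v * eta_partial N))"
    by (intro convergent_imp_Bseq) (auto simp: convergent_def)
  then obtain K where K: "K > 0" "\<And>N. norm (exp (v * eta_partial N)) \<le> K"
    by (auto simp: Bseq_def)
  have "Re (v * eta_partial N) \<le> ln K" for N
    using K(2)[of N] K(1) unfolding norm_exp_eq_Re by (simp only: ln_ge_iff)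
  then show ?thesis by (rule that)
qed

text \<open>Sigma is nonzero near \<open>- w1\<close>, so all \<open>v\<close> in a small disc are
  admissible, in particular the four axis directions.\<close>

lemma bounded_eta_partial: "bounded (range eta_partial)"
proof -
  have "isCont (wsigma w1 w2) (- w1)" and "wsigma w1 w2 (- w1) \<noteq> 0"
    using entire_imp_isCont[OF wsigma_entire] odd_half_period_nz[of "-1" 0] by auto
  then obtain U where U: "open U" "- w1 \<in> U" "\<And>z. z \<in> U \<Longrightarrow> wsigma w1 w2 z \<noteq> 0"
    using isCont_nonzero_neighbourhood by blast
  then obtain r where r: "r > 0" "cball (- w1) r \<subseteq> U"
    using open_contains_cball by blast
  have nz: "wsigma w1 w2 (v - w1) \<noteq> 0" if "norm v \<le> r" for v
  proof -
    have "v - w1 \<in> cball (- w1) r"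
      using that by (simp add: dist_norm norm_minus_commute)
    then show ?thesis using r(2) U(3) by blast
  qed
  have "\<exists>B. \<forall>N. Re (v * eta_partial N) \<le> B" if "norm v \<le> r" for v
    using Re_eta_partial_bounded_above[OF nz[OF that]] by metis
  from this[of "of_real r"] this[of "- of_real r"] this[of "of_real r * \<i>"] this[of "- of_real r * \<i>"]
  obtain B1 B2 B3 B4 where B: "\<And>N. Re (of_real r * eta_partial N) \<le> B1"
    "\<And>N. Re (- of_real r * eta_partial N) \<le> B2"
    "\<And>N. Re (of_real r * \<i> * eta_partial N) \<le> B3"
    "\<And>N. Re (- of_real r * \<i> * eta_partial N) \<le> B4"
    using r(1) by (auto simp: norm_mult)
  have "norm (eta_partial N) \<le> 2 * max (max B1 B2) (max B3 B4) / r" for N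
    using B[of N] by (intro norm_bounds_of_Re r(1)) (auto simp: le_max_iff_disj)
  then show ?thesis
    by (auto simp: bounded_iff)
qed

lemma wsigma_quasi_period_w1:
  obtains \<eta> where "\<And>u. wsigma w1 w2 (u + 2 * w1) = - exp (\<eta> * (u + w1)) * wsigma w1 w2 u"
proof -
  obtain \<eta> \<rho> where \<rho>: "strict_mono (\<rho> :: nat \<Rightarrow> nat)" and \<eta>: "(eta_partial \<circ> \<rho>) \<longlonglongrightarrow> \<eta>"
    using bounded_imp_convergent_subsequence[OF bounded_eta_partial] by blast
  have sub: "(\<lambda>N. f (\<rho> N)) \<longlonglongrightarrow> l" if "f \<longlonglongrightarrow> l" for f and l :: complex
    using LIMSEQ_subseq_LIMSEQ[OF that \<rho>] by (simp add: o_def)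
  have "wsigma w1 w2 (u + 2 * w1) = - exp (\<eta> * (u + w1)) * wsigma w1 w2 u" for u
  proof -
    have "(\<lambda>N. wsigma_partial w1 w2 (\<rho> N) (u + 2 * w1) * strip_prod (\<rho> N) (u + w1))
            \<longlonglongrightarrow> wsigma w1 w2 (u + 2 * w1) * 1"
      by (intro tendsto_mult sub wsigma_LIMSEQ strip_prod_LIMSEQ)
    moreover have "(\<lambda>N. - exp ((u + w1) * eta_partial (\<rho> N)) * wsigma_partial w1 w2 (\<rho> N) u *
              strip_prod (\<rho> N) (- (u + w1)))
            \<longlonglongrightarrow> - exp ((u + w1) * \<eta>) * wsigma w1 w2 u * 1"
      using \<eta> by (intro tendsto_mult tendsto_minus tendsto_exp tendsto_const sub[of "\<lambda>N. wsigma_partial w1 w2 N u"]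
          sub[of "\<lambda>N. strip_prod N (- (u + w1))"] wsigma_LIMSEQ strip_prod_LIMSEQ) (simp add: o_def)
    ultimately show ?thesis
      unfolding wsigma_partial_shift[OF refl] by (auto dest: LIMSEQ_unique simp: mult.commute)
  qed
  then show ?thesis by (rule that)
qed

lemma wsigma_quasi_period_w2:
  obtains \<eta> where "\<And>u. wsigma w1 w2 (u + 2 * w2) = - exp (\<eta> * (u + w2)) * wsigma w1 w2 u"
proof -
  have "Im (inverse (w2 / w1)) \<noteq> 0"
    using Im_nz by (auto simp: Im_inverse sum_power2_eq_zero_iff simp del: inverse_divide)
  then interpret swap: period_lattice w2 w1
    by unfold_locales simp
  show ?thesis
    using swap.wsigma_quasi_period_w1 that unfolding wsigma_swap[of w2 w1] by blast
qed

text \<open>The codomain of \<open>P\<close> is arbitrary: the lemma serves elliptic functions and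
  also predicates such as vanishing at a point.\<close>

lemma lattice_periodic:
  assumes "\<And>z. P (z + 2 * w1) = P z" "\<And>z. P (z + 2 * w2) = P z"
  shows "P (z + lattice_pt w1 w2 p) = P z"
proof -
  have multiple: "P (z + 2 * of_int m * w) = P z" if "\<And>z. P (z + 2 * w) = P z" for w m z
  proof (induction m rule: int_induct[where k = 0])
    case (step1 m)
    then show ?case
      using that[of "z + 2 * of_int m * w"] by (simp add: algebra_simps)
  next
    case (step2 m)
    then show ?case
      using that[of "z + 2 * of_int (m - 1) * w"] by (simp add: algebra_simps)
  qed auto
  show ?thesis
    using multiple[OF assms(2), of "z + 2 * of_int (fst p) * w1"] multiple[OF assms(1)]
    by (simp add: lattice_pt_def add.assoc)
qed

text \<open>The shifts that act by the exponential of an affine function form a group containing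
  both periods; the minus sign is absorbed as \<open>exp (\<i> * pi)\<close>.\<close>

lemma wsigma_lattice_shift:
  obtains a b where "\<And>u. wsigma w1 w2 (u + lattice_pt w1 w2 p) = exp (a * u + b) * wsigma w1 w2 u"
proof -
  define P where "P w \<longleftrightarrow> (\<exists>a b. \<forall>u. wsigma w1 w2 (u + w) = exp (a * u + b) * wsigma w1 w2 u)" for w
  have P_add: "P (x + y)" if xy: "P x" "P y" for x y
  proof -
    obtain a b c d where *: "\<And>u. wsigma w1 w2 (u + x) = exp (a * u + b) * wsigma w1 w2 u"
      "\<And>u. wsigma w1 w2 (u + y) = exp (c * u + d) * wsigma w1 w2 u"
      using xy unfolding P_def by blast
    have "wsigma w1 w2 (u + (x + y)) = exp ((a + c) * u + (b + d + c * x)) * wsigma w1 w2 u" for u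
      using *(1)[of u] *(2)[of "u + x"] by (simp add: exp_add algebra_simps)
    then show ?thesis unfolding P_def by blast
  qed
  have P_minus: "P (- x)" if x: "P x" for x
  proof -
    obtain a b where *: "\<And>u. wsigma w1 w2 (u + x) = exp (a * u + b) * wsigma w1 w2 u"
      using x unfolding P_def by blast
    have "wsigma w1 w2 (u + - x) = exp (- a * u + (a * x - b)) * wsigma w1 w2 u" for u
      using *[of "u - x"] by (simp add: exp_add exp_diff exp_minus field_simps)
    then show ?thesis unfolding P_def by blast
  qed
  have P_period: "P (2 * w)"
    if "\<And>u. wsigma w1 w2 (u + 2 * w) = - exp (\<eta> * (u + w)) * wsigma w1 w2 u" for w \<eta>
  proof -
    have "wsigma w1 w2 (u + 2 * w) = exp (\<eta> * u + (\<eta> * w + \<i> * pi)) * wsigma w1 w2 u" for u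
      using that[of u] by (simp add: exp_add algebra_simps)
    then show ?thesis unfolding P_def by blast
  qed
  have P_iff: "P (z + 2 * w) = P z" if "P (2 * w)" for z w
    using P_add[of z "2 * w"] P_add[of "z + 2 * w" "- (2 * w)"] P_minus that by auto
  have "P (2 * w1)" "P (2 * w2)"
    using wsigma_quasi_period_w1 wsigma_quasi_period_w2 P_period by metis+
  then have "P (0 + lattice_pt w1 w2 p) = P 0"
    by (intro lattice_periodic P_iff)
  moreover have "P 0"
    unfolding P_def by (intro exI[of _ 0]) auto
  ultimately have "P (lattice_pt w1 w2 p)"
    by simp
  then show ?thesis using that unfolding P_def by blast
qed

lemma wsigma_eq_0_iff: "wsigma w1 w2 u = 0 \<longleftrightarrow> u \<in> range (lattice_pt w1 w2)"
proof
  assume "u \<in> range (lattice_pt w1 w2)"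
  then obtain p where p: "u = lattice_pt w1 w2 p" by blast
  obtain a b where "\<And>u. wsigma w1 w2 (u + lattice_pt w1 w2 p) = exp (a * u + b) * wsigma w1 w2 u"
    using wsigma_lattice_shift by blast
  from this[of 0] show "wsigma w1 w2 u = 0" by (simp add: p)
qed (use wsigma_nz in blast)

text \<open>The shift law carries the derivative 1 at the origin to every other zero, where it
  becomes \<open>exp b\<close>.\<close>

lemma deriv_wsigma_nz:
  assumes "wsigma w1 w2 u = 0"
  shows "deriv (wsigma w1 w2) u \<noteq> 0"
proof -
  obtain p where p: "u = lattice_pt w1 w2 p"
    using assms wsigma_eq_0_iff by blast
  obtain a b where ab: "\<And>u. wsigma w1 w2 (u + lattice_pt w1 w2 p) = exp (a * u + b) * wsigma w1 w2 u"
    using wsigma_lattice_shift by blast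
  have "((\<lambda>z. exp (a * z + b) * wsigma w1 w2 z) has_field_derivative exp b) (at 0)"
    using wsigma_DERIV[of 0] by (auto intro!: derivative_eq_intros)
  moreover have "((\<lambda>z. wsigma w1 w2 (z + u)) has_field_derivative deriv (wsigma w1 w2) u) (at 0)"
    using DERIV_shift[of "wsigma w1 w2" "deriv (wsigma w1 w2) u" 0 u] wsigma_DERIV[of u] by simp
  ultimately have "deriv (wsigma w1 w2) u = exp b"
    unfolding ab[folded p] by (rule DERIV_unique[rotated])
  then show ?thesis by simp
qed

section \<open>Elliptic functions and the uniqueness of sigma among theta functions\<close>

lemma entire_periodic_constant:
  assumes hol: "q holomorphic_on UNIV"
    and per: "\<And>z. q (z + 2 * w1) = q z" "\<And>z. q (z + 2 * w2) = q z"
  obtains c where "\<And>z. q z = c"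
proof -
  define t where "t = w2 / w1"
  have Im: "Im t \<noteq> 0"
    using Im_nz by (simp add: t_def)
  define R where "R = 2 * norm w1 + 2 * norm w2"
  have "q z \<in> q ` cball 0 R" for z
  proof -
    define y where "y = Im (z / w1) / Im t"
    define x where "x = Re (z / w1) - y * Re t"
    have "z / w1 = of_real x + of_real y * t"
      using Im by (simp add: complex_eq_iff x_def y_def)
    then have z: "z = of_real x * w1 + of_real y * w2"
      using w1_nz by (simp add: t_def field_simps)
    define p where "p = (- \<lfloor>x / 2\<rfloor>, - \<lfloor>y / 2\<rfloor>)"
    have "z + lattice_pt w1 w2 p = of_real (2 * frac (x / 2)) * w1 + of_real (2 * frac (y / 2)) * w2"
      by (simp add: z p_def lattice_pt_def frac_def algebra_simps)
    also have "norm \<dots> \<le> 2 * frac (x / 2) * norm w1 + 2 * frac (y / 2) * norm w2"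
      by (rule order.trans[OF norm_triangle_ineq]) (simp add: norm_mult)
    also have "\<dots> \<le> 2 * 1 * norm w1 + 2 * 1 * norm w2"
      using frac_lt_1[of "x / 2"] frac_lt_1[of "y / 2"]
      by (intro add_mono mult_right_mono) auto
    finally have "z + lattice_pt w1 w2 p \<in> cball 0 R"
      by (simp add: R_def)
    then show ?thesis
      using lattice_periodic[of q, OF per, of z p] by (metis imageI)
  qed
  then have "range q = q ` cball 0 R" by auto
  moreover have "compact (q ` cball 0 R)"
    using holomorphic_on_imp_continuous_on[OF holomorphic_on_subset[OF hol]]
    by (intro compact_continuous_image) auto
  ultimately have "bounded (range q)"
    by (simp add: compact_imp_bounded)
  then show ?thesis
    using Liouville_theorem[OF hol] that by (auto simp: constant_on_def)
qed

lemma quasi_periodic_zero_lattice: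
  assumes "\<And>z. F (z + 2 * w1) = - exp (\<eta>1 * (z + w1)) * F z"
    and "\<And>z. F (z + 2 * w2) = - exp (\<eta>2 * (z + w2)) * (F z :: complex)"
  shows "F (z + lattice_pt w1 w2 p) = 0 \<longleftrightarrow> F z = 0"
  by (rule lattice_periodic[of "\<lambda>z. F z = 0"]) (auto simp: assms)

text \<open>The even part \<open>E\<close> of a theta function \<open>G\<close> with the multipliers of \<open>\<sigma>\<close> vanishes at the half
  periods, so \<open>E z * E (z + w2) / (\<sigma> z * \<sigma> (z + w2))\<close> is entire, elliptic, and zero at \<open>w1\<close>. This
  replaces the residue argument that an elliptic function cannot have a single simple pole.\<close>

lemma quasi_periodic_eq_wsigma:
  assumes hol: "G holomorphic_on UNIV"
    and G1: "\<And>z. G (z + 2 * w1) = - exp (\<eta>1 * (z + w1)) * G z"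
    and G2: "\<And>z. G (z + 2 * w2) = - exp (\<eta>2 * (z + w2)) * G z"
    and s1: "\<And>z. wsigma w1 w2 (z + 2 * w1) = - exp (\<eta>1 * (z + w1)) * wsigma w1 w2 z"
    and s2: "\<And>z. wsigma w1 w2 (z + 2 * w2) = - exp (\<eta>2 * (z + w2)) * wsigma w1 w2 z"
  obtains c where "\<And>z. G z = c * wsigma w1 w2 z"
proof -
  let ?s = "wsigma w1 w2"
  define E where "E z = G z + G (- z)" for z
  define D where "D z = G z - G (- z)" for z
  have neg: "G (- (z + 2 * w)) = - exp (\<eta> * (z + w)) * G (- z)"
    if "\<And>z. G (z + 2 * w) = - exp (\<eta> * (z + w)) * G z" for \<eta> z w
  proof -
    have "exp (\<eta> * (z + w)) * exp (\<eta> * (- (z + 2 * w) + w)) = 1"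
      by (simp add: exp_add[symmetric] algebra_simps)
    then show ?thesis
      using that[of "- (z + 2 * w)"] by (simp add: mult.assoc[symmetric])
  qed
  have E1: "E (z + 2 * w1) = - exp (\<eta>1 * (z + w1)) * E z"
    and E2: "E (z + 2 * w2) = - exp (\<eta>2 * (z + w2)) * E z"
    and D1: "D (z + 2 * w1) = - exp (\<eta>1 * (z + w1)) * D z"
    and D2: "D (z + 2 * w2) = - exp (\<eta>2 * (z + w2)) * D z" for z
    unfolding E_def D_def neg[OF G1] neg[OF G2] G1 G2 by (simp_all add: algebra_simps)
  have E_neg: "E (- z) = E z" for z by (simp add: E_def)
  have holG': "(\<lambda>z. G (- z)) holomorphic_on UNIV"
    by (rule entire_compose[OF hol]) (intro holomorphic_intros)
  have holE: "E holomorphic_on UNIV" and holD: "D holomorphic_on UNIV"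
    unfolding E_def[abs_def] D_def[abs_def]
    by (rule holomorphic_on_add[OF hol holG'], rule holomorphic_on_diff[OF hol holG'])
  \<comment> \<open>At \<open>z = - w\<close> the multiplier is \<open>- 1\<close>, so evenness
    gives \<open>E w = - E w\<close>.\<close>
  have E_w1: "E w1 = 0" and E_w2: "E w2 = 0"
    using E1[of "- w1"] E2[of "- w2"] by (simp_all add: E_neg eq_neg_iff_add_eq_0)
  have E_lattice: "E (z + lattice_pt w1 w2 p) = 0 \<longleftrightarrow> E z = 0" for z p
    by (rule quasi_periodic_zero_lattice[OF E1 E2])

  \<comment> \<open>The translate makes the division possible: \<open>E (z + w2)\<close> vanishes at
    the zeros of \<open>\<sigma> z\<close>, and \<open>E z\<close> at those of
    \<open>\<sigma> (z + w2)\<close>.\<close>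
  have EE: "E z * E (z + w2) = 0" for z
  proof -
    define s where "s i z = ?s (z + of_nat i * w2)" for i :: nat and z
    have hol_s: "s i holomorphic_on UNIV" for i
      unfolding s_def[abs_def] by (intro holomorphic_intros)
    have s_lattice: "\<exists>p. z + of_nat i * w2 = lattice_pt w1 w2 p" if "s i z = 0" for i z
      using that wsigma_eq_0_iff[of "z + of_nat i * w2"] unfolding s_def by blast
    have "\<exists>q. q holomorphic_on UNIV \<and> (\<forall>z. E z * E (z + w2) = q z * (\<Prod>i\<in>{0, 1}. s i z))"
    proof (rule entire_divide_prod_simple_zeros[where f = "\<lambda>z. E z * E (z + w2)" and s = s])
      show "(\<lambda>z. E z * E (z + w2)) holomorphic_on UNIV"
        by (rule holomorphic_on_mult[OF holE entire_shift[OF holE]])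
      fix i j z assume i: "i \<in> {0, 1::nat}" and j: "j \<in> {0, 1::nat}" and z: "s i z = 0"
      have "deriv (s i) z = deriv ?s (z + of_nat i * w2)"
        unfolding s_def
        by (rule DERIV_imp_deriv, subst DERIV_shift[symmetric], rule wsigma_DERIV)
      then show "deriv (s i) z \<noteq> 0"
        using z deriv_wsigma_nz by (simp add: s_def)
      obtain p where p: "z + of_nat i * w2 = lattice_pt w1 w2 p"
        using s_lattice[OF z] by blast
      show "E z * E (z + w2) = 0"
      proof (cases "i = 0")
        case True
        then show ?thesis
          using p E_lattice[of w2 p] E_w2 by (simp add: add.commute)
      next
        case False
        then have "z = - w2 + lattice_pt w1 w2 p"
          using p i by (simp add: algebra_simps)
        then show ?thesis
          using E_lattice[of "- w2" p] E_w2 E_neg by simp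
      qed
      assume ij: "i \<noteq> j"
      show "s j z \<noteq> 0"
      proof
        assume "s j z = 0"
        then obtain r where r: "z + of_nat j * w2 = lattice_pt w1 w2 r"
          using s_lattice by blast
        define d where "d = (if i = 0 then r - p else p - r)"
        have "w2 = lattice_pt w1 w2 d"
          using p r i j ij by (auto simp: d_def lattice_pt_def algebra_simps)
        then have "?s w2 = 0"
          using wsigma_eq_0_iff[of w2] by blast
        then show False
          using odd_half_period_nz[of 0 1] by simp
      qed
    qed (use hol_s in auto)
    then obtain q where q: "q holomorphic_on UNIV" "\<And>z. E z * E (z + w2) = q z * (?s z * ?s (z + w2))"
      by (auto simp: s_def)
    have q_per: "q (z + 2 * w) = q z"
      if *: "\<And>z. E (z + 2 * w) = - exp (\<eta> * (z + w)) * E z"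
        "\<And>z. ?s (z + 2 * w) = - exp (\<eta> * (z + w)) * ?s z" for z w \<eta>
    proof (rule entire_eqI_off_zeros[where f = "\<lambda>z. q (z + 2 * w)" and g = q and s = "\<lambda>z. ?s z * ?s (z + w2)" and ?z0.0 = w1])
      show "(\<lambda>z. q (z + 2 * w)) holomorphic_on UNIV"
        by (rule entire_shift[OF q(1)])
      show "?s w1 * ?s (w1 + w2) \<noteq> 0"
        using odd_half_period_nz[of 1 0] odd_half_period_nz[of 1 1] by simp
      fix z assume nz: "?s z * ?s (z + w2) \<noteq> 0"
      let ?m = "exp (\<eta> * (z + w)) * exp (\<eta> * (z + w2 + w))"
      have "?m * (q z * (?s z * ?s (z + w2))) = E (z + 2 * w) * E (z + w2 + 2 * w)"
        by (simp add: * flip: q(2))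
      also have "\<dots> = q (z + 2 * w) * (?s (z + 2 * w) * ?s (z + w2 + 2 * w))"
        using q(2)[of "z + 2 * w"] by (simp add: add_ac)
      also have "\<dots> = ?m * (q (z + 2 * w) * (?s z * ?s (z + w2)))"
        by (simp add: *)
      finally show "q (z + 2 * w) = q z"
        using nz by simp
    qed (use q(1) in \<open>auto intro!: holomorphic_intros\<close>)
    obtain c where c: "\<And>z. q z = c"
      by (rule entire_periodic_constant[OF q(1) q_per[OF E1 s1] q_per[OF E2 s2]]) blast
    have "c = 0"
      using q(2)[of w1] E_w1 odd_half_period_nz[of 1 0] odd_half_period_nz[of 1 1] by (simp add: c)
    then show ?thesis
      using q(2) c by simp
  qed
  \<comment> \<open>No zero divisors: if \<open>E\<close> were not identically zero, its translate
    would be, and with it \<open>E\<close>.\<close>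
  have E0: "E z0 = 0" for z0
  proof (rule ccontr)
    assume nz: "E z0 \<noteq> 0"
    have "E (z0 - w2 + w2) = 0"
    proof (rule entire_eqI_off_zeros[where s = E and f = "\<lambda>z. E (z + w2)" and g = "\<lambda>_. 0", OF _ _ holE nz])
      show "(\<lambda>z. E (z + w2)) holomorphic_on UNIV"
        by (rule entire_shift[OF holE])
    qed (use EE in auto)
    then show False using nz by simp
  qed

  \<comment> \<open>The odd part vanishes at 0, hence on the lattice, so it can be divided by sigma
    directly.\<close>
  have "D z = 0" if z: "?s z = 0" for z
  proof -
    obtain p where "z = lattice_pt w1 w2 p"
      using z wsigma_eq_0_iff by blast
    then show ?thesis
      using quasi_periodic_zero_lattice[OF D1 D2, of 0 p] by (simp add: D_def)
  qed
  then obtain q where q: "q holomorphic_on UNIV" "\<And>z. D z = q z * ?s z"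
    using entire_divide_simple_zeros[OF holD wsigma_entire deriv_wsigma_nz] by blast
  have q_per: "q (z + 2 * w) = q z"
    if *: "\<And>z. D (z + 2 * w) = - exp (\<eta> * (z + w)) * D z"
      "\<And>z. ?s (z + 2 * w) = - exp (\<eta> * (z + w)) * ?s z" for z w \<eta>
  proof (rule entire_eqI_off_zeros[where f = "\<lambda>z. q (z + 2 * w)" and g = q and s = ?s and ?z0.0 = w1])
    show "(\<lambda>z. q (z + 2 * w)) holomorphic_on UNIV"
      by (rule entire_shift[OF q(1)])
    show "?s w1 \<noteq> 0"
      using odd_half_period_nz[of 1 0] by simp
    fix z assume "?s z \<noteq> 0"
    then show "q (z + 2 * w) = q z"
      using *(1)[of z] by (simp add: q(2) *(2))
  qed (use q(1) wsigma_entire in auto)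
  obtain c where c: "\<And>z. q z = c"
    by (rule entire_periodic_constant[OF q(1) q_per[OF D1 s1] q_per[OF D2 s2]]) blast
  have "G z = c / 2 * ?s z" for z
  proof -
    have "E z + D z = 2 * G z" unfolding E_def D_def by simp
    then show ?thesis unfolding E0 q(2) c by simp
  qed
  then show ?thesis by (rule that)
qed

end

section \<open>Powers of the shifted derivative\<close>

lemma higher_deriv_exp_linear: "(deriv ^^ k) (\<lambda>v. exp (c * v)) = (\<lambda>v. c ^ k * exp (c * v :: complex))"
proof (induction k)
  case (Suc k)
  have "deriv (\<lambda>v. c ^ k * exp (c * v)) v = c ^ Suc k * exp (c * v)" for v
    by (rule DERIV_imp_deriv) (auto intro!: derivative_eq_intros)
  then show ?case by (simp only: funpow.simps o_def Suc.IH)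
qed auto

text \<open>\<open>exp (c * v)\<close> is an integrating factor: conjugation by it turns the shifted
  derivative into the plain one.\<close>

lemma shifted_deriv_pow_eq:
  assumes f: "f holomorphic_on S" and S: "open S" and "v \<in> S"
  shows "shifted_deriv_pow c k f v = exp (- c * v) * (deriv ^^ k) (\<lambda>v. exp (c * v) * f v) v"
  using assms(3)
proof (induction k arbitrary: v)
  case 0
  then show ?case by (simp add: exp_minus field_simps)
next
  case (Suc k)
  define g where "g = (deriv ^^ k) (\<lambda>v. exp (c * v) * f v)"
  have "g holomorphic_on S"
    unfolding g_def by (intro holomorphic_intros f S)
  then have g: "(g has_field_derivative deriv g v) (at v)"
    using S Suc.prems holomorphic_derivI by blast
  have "((\<lambda>v. exp (- c * v) * g v) has_field_derivative
      exp (- c * v) * deriv g v - c * exp (- c * v) * g v) (at v)"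
    by (auto intro!: derivative_eq_intros g)
  then have "(shifted_deriv_pow c k f has_field_derivative
      exp (- c * v) * deriv g v - c * exp (- c * v) * g v) (at v)"
    by (rule has_field_derivative_transform_within_open[OF _ S Suc.prems]) (simp add: Suc.IH g_def)
  then have "deriv (shifted_deriv_pow c k f) v = exp (- c * v) * deriv g v - c * exp (- c * v) * g v"
    by (rule DERIV_imp_deriv)
  then show ?case
    using Suc.IH[OF Suc.prems] by (simp add: g_def[symmetric])
qed

text \<open>Leibniz rule for the conjugated form. With \<open>c = wzeta w1 w2 z\<close> it displays
  \<open>phi_tilde\<close> as a polynomial in zeta, whose poles can be cleared.\<close>

lemma shifted_deriv_pow_expand:
  assumes "f holomorphic_on S" "open S" "v \<in> S"
  shows "shifted_deriv_pow c k f v =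
    (\<Sum>j = 0..k. of_nat (k choose j) * c ^ j * (deriv ^^ (k - j)) f v)"
proof -
  have "(\<lambda>v. exp (c * v)) holomorphic_on S"
    by (intro holomorphic_intros)
  then have "(deriv ^^ k) (\<lambda>v. exp (c * v) * f v) v =
      (\<Sum>j = 0..k. of_nat (k choose j) * (deriv ^^ j) (\<lambda>v. exp (c * v)) v * (deriv ^^ (k - j)) f v)"
    by (rule higher_deriv_mult[OF _ assms])
  also have "\<dots> = exp (c * v) * (\<Sum>j = 0..k. of_nat (k choose j) * c ^ j * (deriv ^^ (k - j)) f v)"
    unfolding higher_deriv_exp_linear by (simp add: sum_distrib_left mult_ac)
  finally show ?thesis
    by (simp add: shifted_deriv_pow_eq[OF assms] exp_minus)
qed

text \<open>Since \<open>exp ((c - a) * v) * exp (a * v) = exp (c * v)\<close>, the two conjugated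
  forms agree up to \<open>K\<close>; the resulting factor is independent of
  \<open>k\<close>.\<close>

lemma shifted_deriv_pow_exp_mult:
  assumes f: "f holomorphic_on S" and S: "open S" and v: "v \<in> S"
  shows "shifted_deriv_pow (c - a) k (\<lambda>v. K * exp (a * v) * f v) v =
    K * exp (a * v) * shifted_deriv_pow c k f v"
proof -
  have f': "(\<lambda>v. K * exp (a * v) * f v) holomorphic_on S"
    by (intro holomorphic_intros f)
  have g: "(\<lambda>v. exp (c * v) * f v) holomorphic_on S"
    by (intro holomorphic_intros f)
  have eq: "(\<lambda>v. exp ((c - a) * v) * (K * exp (a * v) * f v)) = (\<lambda>v. K * (exp (c * v) * f v))"
    by (simp add: fun_eq_iff left_diff_distrib exp_diff)
  show ?thesis
    unfolding shifted_deriv_pow_eq[OF f' S v] shifted_deriv_pow_eq[OF f S v] eq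
      higher_deriv_cmult[OF g v S]
    by (simp add: left_diff_distrib exp_diff exp_minus field_simps)
qed

lemma shifted_deriv_pow_holomorphic:
  assumes "f holomorphic_on S" "open S"
  shows "shifted_deriv_pow c k f holomorphic_on S"
proof (induction k)
  case (Suc k)
  then show ?case
    using assms(2) unfolding shifted_deriv_pow.simps
    by (intro holomorphic_on_add holomorphic_on_mult holomorphic_on_const holomorphic_deriv)
qed (simp add: assms(1))

section \<open>Determinants\<close>

text \<open>Cofactors along column \<open>k\<close> do not see that column. Hence they also expand
  the determinant with any other column put there.\<close>

lemma det_replace_column:
  fixes f :: "nat \<Rightarrow> nat \<Rightarrow> 'a :: comm_ring_1"
  assumes "k < n"
  shows "det (mat n n (\<lambda>(i, j). if j = k then x i else f i j)) =
    (\<Sum>i<n. x i * cofactor (mat n n (\<lambda>(i, j). f i j)) i k)"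
proof -
  let ?B = "mat n n (\<lambda>(i, j). if j = k then x i else f i j)"
  have "mat_delete ?B i k = mat_delete (mat n n (\<lambda>(i, j). f i j)) i k" for i
    by (rule eq_matI) (auto simp: mat_delete_def)
  then have "cofactor ?B i k = cofactor (mat n n (\<lambda>(i, j). f i j)) i k" for i
    by (simp add: cofactor_def)
  then show ?thesis
    using assms by (simp add: laplace_expansion_column[of ?B n k])
qed

lemma sum_column_cofactor_eq_0:
  fixes f :: "nat \<Rightarrow> nat \<Rightarrow> 'a :: comm_ring_1"
  assumes "k < n" "l < n" "k \<noteq> l"
  shows "(\<Sum>i<n. f i l * cofactor (mat n n (\<lambda>(i, j). f i j)) i k) = 0"
  unfolding det_replace_column[OF assms(1), symmetric]
  by (rule det_identical_columns[of _ n k l]) (use assms in \<open>auto intro!: eq_vecI\<close>)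

lemma det_proportional_columns:
  fixes f :: "nat \<Rightarrow> nat \<Rightarrow> 'a :: comm_ring_1"
  assumes "k < n" "l < n" "k \<noteq> l" and col: "\<And>i. f i k = c * f i l"
  shows "det (mat n n (\<lambda>(i, j). f i j)) = 0"
proof -
  have "det (mat n n (\<lambda>(i, j). f i j)) =
      (\<Sum>i<n. f i k * cofactor (mat n n (\<lambda>(i, j). f i j)) i k)"
    using assms(1) by (simp add: laplace_expansion_column[of _ n k])
  also have "\<dots> = c * (\<Sum>i<n. f i l * cofactor (mat n n (\<lambda>(i, j). f i j)) i k)"
    by (simp add: col sum_distrib_left mult.assoc)
  finally show ?thesis
    unfolding sum_column_cofactor_eq_0[OF assms(1-3), of f] by simp
qed

lemma isCont_det:
  fixes f :: "complex \<Rightarrow> nat \<Rightarrow> nat \<Rightarrow> complex"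
  assumes "\<And>i j. i < n \<Longrightarrow> j < n \<Longrightarrow> isCont (\<lambda>x. f x i j) a"
  shows "isCont (\<lambda>x. det (mat n n (\<lambda>(i, j). f x i j))) a"
proof -
  have less: "p i < n" if "p permutes {0..<n}" "i < n" for p i
    using permutes_in_image[OF that(1), of i] that(2) by simp
  have "det (mat n n (\<lambda>(i, j). f x i j)) =
      (\<Sum>p | p permutes {0..<n}. signof p * (\<Prod>i = 0..<n. f x i (p i)))" for x
  proof -
    have "(\<Prod>i = 0..<n. mat n n (\<lambda>(i, j). f x i j) $$ (i, p i)) = (\<Prod>i = 0..<n. f x i (p i))"
      if "p permutes {0..<n}" for p
      using less[OF that] by (intro prod.cong) auto
    then show ?thesis
      by (simp add: det_def'[of _ n])
  qed
  moreover have "isCont (\<lambda>x. \<Sum>p | p permutes {0..<n}. signof p * (\<Prod>i = 0..<n. f x i (p i))) a"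
  proof (intro isCont_sum isCont_mult continuous_const continuous_prod ballI)
    fix p i assume "p \<in> {p. p permutes {0..<n}}" "i \<in> {0..<n}"
    then show "isCont (\<lambda>x. f x i (p i)) a"
      using less by (intro assms) auto
  qed
  ultimately show ?thesis by simp
qed

section \<open>The determinant formula\<close>

context period_lattice
begin

lemma wsigma_minus_shift:
  assumes "\<And>z. wsigma w1 w2 (z + 2 * w) = - exp (\<eta> * (z + w)) * wsigma w1 w2 z"
  shows "wsigma w1 w2 (u - 2 * w) = - exp (- \<eta> * (u - w)) * wsigma w1 w2 u"
proof -
  have "u - 2 * w + w = u - w" by simp
  then have "wsigma w1 w2 u = - exp (\<eta> * (u - w)) * wsigma w1 w2 (u - 2 * w)"
    using assms[of "u - 2 * w"] by simp
  moreover have "exp (- \<eta> * (u - w)) = inverse (exp (\<eta> * (u - w)))"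
    by (simp flip: exp_minus)
  ultimately show ?thesis by simp
qed

lemma open_wsigma_nz: "open {v. wsigma w1 w2 v \<noteq> 0}"
proof -
  have "continuous_on UNIV (wsigma w1 w2)"
    using wsigma_entire by (rule holomorphic_on_imp_continuous_on)
  then show ?thesis
    by (intro open_Collect_neq continuous_on_const)
qed

lemma wsigma_quotient_holomorphic:
  "(\<lambda>v. wsigma w1 w2 (v - a) / wsigma w1 w2 v) holomorphic_on {v. wsigma w1 w2 v \<noteq> 0}"
  by (intro holomorphic_intros) auto

text \<open>Logarithmic differentiation of the shift law lowers zeta by \<open>a\<close>, the
  quotient gains \<open>exp (a * v)\<close>, and the two compensate. The factor does not depend on
  the row \<open>i\<close>.\<close>

lemma phi_tilde_shift:
  assumes e: "wsigma w1 w2 e \<noteq> 0" and z: "wsigma w1 w2 z \<noteq> 0" and "K \<noteq> 0"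
    and shift: "\<And>u. wsigma w1 w2 (u - w) = K * exp (a * u) * wsigma w1 w2 u"
  shows "phi_tilde w1 w2 e i (z + w) = K * exp (a * (e - z)) * phi_tilde w1 w2 e i z"
proof -
  let ?s = "wsigma w1 w2" and ?S = "{v. wsigma w1 w2 v \<noteq> 0}"
  have s_shift: "?s z = K * exp (a * (z + w)) * ?s (z + w)"
    using shift[of "z + w"] by simp
  then have zw: "?s (z + w) \<noteq> 0"
    using z by auto
  have "((\<lambda>u. ?s (u - w)) has_field_derivative deriv ?s z) (at (z + w))"
    using DERIV_shift[of ?s "deriv ?s z" "z + w" "- w"] wsigma_DERIV[of z] by simp
  moreover have "((\<lambda>u. K * exp (a * u) * ?s u) has_field_derivative
      K * exp (a * (z + w)) * (a * ?s (z + w) + deriv ?s (z + w))) (at (z + w))"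
    by (auto intro!: derivative_eq_intros wsigma_DERIV simp: algebra_simps)
  ultimately have "deriv ?s z = K * exp (a * (z + w)) * (a * ?s (z + w) + deriv ?s (z + w))"
    unfolding shift by (rule DERIV_unique)
  then have zeta: "wzeta w1 w2 (z + w) = wzeta w1 w2 z - a"
    unfolding wzeta_def using zw \<open>K \<noteq> 0\<close> by (subst s_shift) (simp add: field_simps)
  have quot: "(\<lambda>v. ?s (v - (z + w)) / ?s v) =
      (\<lambda>v. K * exp (- a * z) * exp (a * v) * (?s (v - z) / ?s v))"
  proof
    fix v
    have "?s (v - (z + w)) = K * exp (a * (v - z)) * ?s (v - z)"
      using shift[of "v - z"] by (simp add: diff_diff_eq)
    also have "exp (a * (v - z)) = exp (- a * z) * exp (a * v)"
      by (simp add: right_diff_distrib flip: exp_add)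
    finally show "?s (v - (z + w)) / ?s v = K * exp (- a * z) * exp (a * v) * (?s (v - z) / ?s v)"
      by simp
  qed
  have "e \<in> ?S" using e by simp
  note sdp = shifted_deriv_pow_exp_mult[OF wsigma_quotient_holomorphic open_wsigma_nz this]
  have "exp (a * (e - z)) = exp (- a * z) * exp (a * e)"
    by (simp add: right_diff_distrib flip: exp_add)
  then show ?thesis
    unfolding phi_tilde_def quot zeta sdp by (simp only: mult.assoc)
qed

text \<open>The function \<open>\<sigma> z ^ i * phi_tilde w1 w2 e i z\<close> with zeta written as
  a quotient and its denominators cleared, so that it makes sense at lattice points too.\<close>

definition phi_entire :: "complex \<Rightarrow> nat \<Rightarrow> complex \<Rightarrow> complex" where
  "phi_entire e i z = (\<Sum>j = 0..i. of_nat (i choose j) * deriv (wsigma w1 w2) z ^ j *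
     wsigma w1 w2 z ^ (i - j) * (deriv ^^ (i - j)) (\<lambda>v. wsigma w1 w2 (v - z) / wsigma w1 w2 v) e)"

text \<open>Isolates the dependence on \<open>z\<close> in derivatives of sigma at
  \<open>e - z\<close>, which makes holomorphy in \<open>z\<close> visible.\<close>

lemma higher_deriv_wsigma_quotient:
  assumes "wsigma w1 w2 e \<noteq> 0"
  shows "(deriv ^^ k) (\<lambda>v. wsigma w1 w2 (v - z) / wsigma w1 w2 v) e =
    (\<Sum>l = 0..k. of_nat (k choose l) * (deriv ^^ l) (wsigma w1 w2) (e - z) *
       (deriv ^^ (k - l)) (\<lambda>v. 1 / wsigma w1 w2 v) e)"
proof -
  let ?s = "wsigma w1 w2" and ?S = "{v. wsigma w1 w2 v \<noteq> 0}"
  have "(deriv ^^ k) (\<lambda>v. ?s (v - z) * (1 / ?s v)) e =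
      (\<Sum>l = 0..k. of_nat (k choose l) * (deriv ^^ l) (\<lambda>v. ?s (v - z)) e *
       (deriv ^^ (k - l)) (\<lambda>v. 1 / ?s v) e)"
    using assms by (intro higher_deriv_mult[of _ ?S] open_wsigma_nz holomorphic_intros) auto
  moreover have "(deriv ^^ l) (\<lambda>v. ?s (v - z)) e = (deriv ^^ l) ?s (e - z)" for l
    using higher_deriv_compose_linear'[OF wsigma_entire open_UNIV open_UNIV, of e 1 "- z" l] by simp
  ultimately show ?thesis by simp
qed

lemma phi_entire_holomorphic:
  assumes "wsigma w1 w2 e \<noteq> 0"
  shows "phi_entire e i holomorphic_on UNIV"
proof -
  have "(\<lambda>z. (deriv ^^ l) (wsigma w1 w2) (e - z)) holomorphic_on UNIV" for l
    by (rule entire_compose[OF holomorphic_higher_deriv[OF wsigma_entire open_UNIV]])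
       (intro holomorphic_intros)
  moreover have "deriv (wsigma w1 w2) holomorphic_on UNIV"
    by (rule holomorphic_deriv[OF wsigma_entire open_UNIV])
  ultimately show ?thesis
    unfolding phi_entire_def[abs_def] higher_deriv_wsigma_quotient[OF assms]
    by (intro holomorphic_on_sum holomorphic_on_mult holomorphic_on_power holomorphic_on_const
        wsigma_entire)
qed

lemma phi_entire_eq:
  assumes e: "wsigma w1 w2 e \<noteq> 0" and z: "wsigma w1 w2 z \<noteq> 0"
  shows "phi_entire e i z = wsigma w1 w2 z ^ i * phi_tilde w1 w2 e i z"
proof -
  have e': "e \<in> {v. wsigma w1 w2 v \<noteq> 0}" using e by simp
  have summand: "wsigma w1 w2 z ^ i * (of_nat (i choose j) * wzeta w1 w2 z ^ j * D) =
      of_nat (i choose j) * deriv (wsigma w1 w2) z ^ j * wsigma w1 w2 z ^ (i - j) * D"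
    if "j \<in> {0..i}" for j D
  proof -
    have "wsigma w1 w2 z ^ i = wsigma w1 w2 z ^ j * wsigma w1 w2 z ^ (i - j)"
      using that by (simp flip: power_add)
    then show ?thesis
      using z by (simp add: wzeta_def power_divide)
  qed
  show ?thesis
    unfolding phi_tilde_def phi_entire_def sum_distrib_left
      shifted_deriv_pow_expand[OF wsigma_quotient_holomorphic open_wsigma_nz e']
    by (rule sum.cong[OF refl], rule summand[symmetric])
qed

text \<open>Only \<open>j = i\<close> avoids a positive power of \<open>\<sigma> 0 = 0\<close>, and
  there the derivative of sigma and the quotient are both 1.\<close>

lemma phi_entire_0:
  assumes "wsigma w1 w2 e \<noteq> 0"
  shows "phi_entire e i 0 = 1"
proof -
  have "phi_entire e i 0 = (\<Sum>j\<in>{i}. of_nat (i choose j) * deriv (wsigma w1 w2) 0 ^ j *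
     wsigma w1 w2 0 ^ (i - j) * (deriv ^^ (i - j)) (\<lambda>v. wsigma w1 w2 (v - 0) / wsigma w1 w2 v) e)"
    unfolding phi_entire_def by (rule sum.mono_neutral_right) auto
  then show ?thesis using assms by simp
qed

lemma isCont_phi_tilde:
  assumes "wsigma w1 w2 e \<noteq> 0"
  shows "isCont (\<lambda>e. phi_tilde w1 w2 e i a) e"
proof -
  have "(\<lambda>e. phi_tilde w1 w2 e i a) holomorphic_on {v. wsigma w1 w2 v \<noteq> 0}"
    unfolding phi_tilde_def
    using shifted_deriv_pow_holomorphic[OF wsigma_quotient_holomorphic open_wsigma_nz] .
  then have "continuous_on {v. wsigma w1 w2 v \<noteq> 0} (\<lambda>e. phi_tilde w1 w2 e i a)"
    by (rule holomorphic_on_imp_continuous_on)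
  then show ?thesis
    using assms open_wsigma_nz by (simp add: continuous_on_eq_continuous_at)
qed

text \<open>With \<open>z\<close> as its last variable, the determinant times \<open>\<sigma> z ^ n\<close> extends to the entire function
  on the left-hand side below; it vanishes at all \<open>\<alpha> j\<close>, and dividing by the corresponding sigma
  factors leaves a function with the multipliers of \<open>\<sigma> (e - (\<Sum>j<n. \<alpha> j) - z)\<close>.\<close>

lemma det_last_column_factorization:
  fixes \<alpha> :: "nat \<Rightarrow> complex" and n :: nat
  assumes e: "wsigma w1 w2 e \<noteq> 0"
    and \<alpha>: "\<And>i. i < n \<Longrightarrow> wsigma w1 w2 (\<alpha> i) \<noteq> 0"
    and distinct: "\<And>i j. i < n \<Longrightarrow> j < n \<Longrightarrow> i \<noteq> j \<Longrightarrow> wsigma w1 w2 (\<alpha> i - \<alpha> j) \<noteq> 0"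
  defines "A \<equiv> mat (Suc n) (Suc n) (\<lambda>(i, j). phi_tilde w1 w2 e i (\<alpha> j))"
  shows "\<exists>c. \<forall>z. (\<Sum>i<Suc n. wsigma w1 w2 z ^ (n - i) * phi_entire e i z * cofactor A i n) =
    c * wsigma w1 w2 (e - (\<Sum>j<n. \<alpha> j) - z) * (\<Prod>j<n. wsigma w1 w2 (\<alpha> j - z))"
proof -
  let ?s = "wsigma w1 w2" and ?S = "\<Sum>j<n. \<alpha> j"
  \<comment> \<open>Row \<open>i\<close> already carries \<open>\<sigma> z ^ i\<close>; the weight
    completes it to \<open>\<sigma> z ^ n\<close> in every row. Cofactors along column
    \<open>n\<close> are constant in \<open>z\<close>.\<close>
  define H where "H z = (\<Sum>i<Suc n. ?s z ^ (n - i) * phi_entire e i z * cofactor A i n)" for z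
  have holH: "H holomorphic_on UNIV"
    unfolding H_def[abs_def]
    by (intro holomorphic_on_sum holomorphic_on_mult holomorphic_on_power holomorphic_on_const
        wsigma_entire phi_entire_holomorphic e)
  have H_eq: "H z = ?s z ^ n * (\<Sum>i<Suc n. phi_tilde w1 w2 e i z * cofactor A i n)" if "?s z \<noteq> 0" for z
  proof -
    have eq: "?s z ^ (n - i) * phi_entire e i z = ?s z ^ n * phi_tilde w1 w2 e i z" if "i < Suc n" for i
    proof -
      have "?s z ^ n = ?s z ^ (n - i) * ?s z ^ i"
        using that by (simp flip: power_add)
      then show ?thesis
        using \<open>?s z \<noteq> 0\<close> by (simp add: phi_entire_eq[OF e])
    qed
    show ?thesis
      unfolding H_def sum_distrib_left
      by (rule sum.cong[OF refl]) (simp only: eq lessThan_iff mult.assoc[symmetric])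
  qed
  have H_shift: "?s z ^ n * H (z + w) = ?s (z + w) ^ n * (K * exp (a * (e - z))) * H z"
    if "?s z \<noteq> 0" "K \<noteq> 0" "\<And>u. ?s (u - w) = K * exp (a * u) * ?s u" for z w K a
  proof -
    have "?s (z + w) \<noteq> 0"
      using that(1) that(3)[of "z + w"] by auto
    then show ?thesis
      by (simp add: H_eq that(1) phi_tilde_shift[OF e that] sum_distrib_left mult_ac
          del: sum.lessThan_Suc)
  qed
  \<comment> \<open>At \<open>\<alpha> j\<close> the last column repeats column \<open>j\<close>;
    \<open>H_shift\<close> spreads this zero over the translates by lattice points.\<close>
  have H_zero: "H z = 0" if j: "j < n" and z: "?s (\<alpha> j - z) = 0" for j z
  proof -
    obtain p where "\<alpha> j - z = lattice_pt w1 w2 p"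
      using z wsigma_eq_0_iff[of "\<alpha> j - z"] by blast
    then have zp: "z = \<alpha> j + - lattice_pt w1 w2 p"
      by (simp add: algebra_simps)
    obtain a b where "\<And>u. ?s (u + lattice_pt w1 w2 p) = exp (a * u + b) * ?s u"
      using wsigma_lattice_shift by blast
    then have ab: "?s (u - - lattice_pt w1 w2 p) = exp b * exp (a * u) * ?s u" for u
      by (simp add: exp_add mult_ac)
    have "(\<Sum>i<Suc n. phi_tilde w1 w2 e i (\<alpha> j) * cofactor A i n) = 0"
      unfolding A_def using j by (intro sum_column_cofactor_eq_0) auto
    then have "H (\<alpha> j) = 0"
      using H_eq \<alpha>[OF j] by simp
    then show ?thesis
      using H_shift[OF \<alpha>[OF j] _ ab] \<alpha>[OF j] by (simp add: zp)
  qed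
  define s where "s j z = ?s (\<alpha> j - z)" for j z
  have hol_s: "s j holomorphic_on UNIV" for j
    unfolding s_def[abs_def] by (rule entire_compose[OF wsigma_entire]) (intro holomorphic_intros)
  have "\<exists>q. q holomorphic_on UNIV \<and> (\<forall>z. H z = q z * (\<Prod>j\<in>{..<n}. s j z))"
  proof (rule entire_divide_prod_simple_zeros[where f = H and s = s])
    fix j z assume j: "j \<in> {..<n}" and z: "s j z = 0"
    have "((\<lambda>z. ?s (\<alpha> j - z)) has_field_derivative deriv ?s (\<alpha> j - z) * (- 1)) (at z)"
      by (rule DERIV_chain2[OF wsigma_DERIV]) (auto intro!: derivative_eq_intros)
    then have "deriv (s j) z = - deriv ?s (\<alpha> j - z)"
      unfolding s_def[abs_def] by (simp add: DERIV_imp_deriv)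
    then show "deriv (s j) z \<noteq> 0"
      using deriv_wsigma_nz z by (simp add: s_def)
    show "H z = 0"
      using H_zero j z by (simp add: s_def)
  next
    fix i j z assume ij: "i \<in> {..<n}" "j \<in> {..<n}" "i \<noteq> j" and z: "s i z = 0"
    show "s j z \<noteq> 0"
    proof
      assume "s j z = 0"
      then obtain p r where "\<alpha> i - z = lattice_pt w1 w2 p" "\<alpha> j - z = lattice_pt w1 w2 r"
        using z unfolding s_def wsigma_eq_0_iff by blast
      then have "\<alpha> i - \<alpha> j = lattice_pt w1 w2 (p - r)"
        by (simp add: lattice_pt_def algebra_simps)
      then have "?s (\<alpha> i - \<alpha> j) = 0"
        using wsigma_eq_0_iff[of "\<alpha> i - \<alpha> j"] by blast
      then show False using distinct ij by simp
    qed
  qed (use holH hol_s in simp_all)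
  then obtain q where q: "q holomorphic_on UNIV" "\<And>z. H z = q z * (\<Prod>j<n. s j z)"
    by blast
  have "\<exists>z. (\<Prod>j\<in>{..<n}. s j z) \<noteq> 0"
  proof (rule entire_prod_nonzero[OF _ hol_s])
    show "\<exists>z. s j z \<noteq> 0" for j
      using odd_half_period_nz[of 1 0] by (intro exI[of _ "\<alpha> j - w1"]) (simp add: s_def)
  qed auto
  then obtain z1 where z1: "(\<Prod>j<n. s j z1) \<noteq> 0"
    by blast
  have "\<exists>z0. ?s z0 * (\<Prod>j<n. s j z0) \<noteq> 0"
  proof (rule ccontr)
    assume "\<nexists>z0. ?s z0 * (\<Prod>j<n. s j z0) \<noteq> 0"
    then have "(\<Prod>j<n. s j z1) = 0"
      using entire_eqI_off_zeros[where f = "\<lambda>z. \<Prod>j<n. s j z" and g = "\<lambda>_. 0" and s = ?s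
          and ?z0.0 = w1 and z = z1] odd_half_period_nz[of 1 0] wsigma_entire
        holomorphic_on_prod[of "{..<n}" s UNIV, OF hol_s] by auto
    then show False using z1 by simp
  qed
  then obtain z0 where z0: "?s z0 * (\<Prod>j<n. s j z0) \<noteq> 0"
    by blast
  \<comment> \<open>The multiplier of \<open>\<sigma> z ^ n\<close> cancels against that of the
    \<open>n\<close> factors \<open>s j\<close> up to \<open>exp (- \<eta> * ?S)\<close>, which
    replaces \<open>e\<close> by \<open>e - ?S\<close>. Reflecting the variable then gives the law
    of sigma itself.\<close>
  have q_shift: "q (e - ?S - (x + 2 * w)) = - exp (\<eta> * (x + w)) * q (e - ?S - x)"
    if sh: "\<And>z. ?s (z + 2 * w) = - exp (\<eta> * (z + w)) * ?s z" for w \<eta> x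
  proof -
    have "q (y + 2 * w) = - exp (- \<eta> * (e - ?S - y - w)) * q y" for y
    proof (rule entire_eqI_off_zeros[where f = "\<lambda>y. q (y + 2 * w)"
          and g = "\<lambda>y. - exp (- \<eta> * (e - ?S - y - w)) * q y"
          and s = "\<lambda>y. ?s y * (\<Prod>j<n. s j y)" and ?z0.0 = z0])
      show "(\<lambda>y. q (y + 2 * w)) holomorphic_on UNIV"
        by (rule entire_shift[OF q(1)])
      show "(\<lambda>y. - exp (- \<eta> * (e - ?S - y - w)) * q y) holomorphic_on UNIV"
        by (intro holomorphic_on_mult holomorphic_on_minus q(1)) (intro holomorphic_intros)
      show "(\<lambda>y. ?s y * (\<Prod>j<n. s j y)) holomorphic_on UNIV"
        by (intro holomorphic_on_mult wsigma_entire holomorphic_on_prod hol_s)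
      fix y assume "?s y * (\<Prod>j<n. s j y) \<noteq> 0"
      then have nz: "?s y \<noteq> 0" "(\<Prod>j<n. s j y) \<noteq> 0" by auto
      have minus: "?s (u - 2 * w) = - exp (\<eta> * w) * exp (- \<eta> * u) * ?s u" for u
        using wsigma_minus_shift[OF sh, of u] by (simp add: exp_add[symmetric] algebra_simps)
      let ?M = "(- exp (\<eta> * (y + w))) ^ n"
      have "s j (y + 2 * w) = - exp (\<eta> * (y + w)) * (exp (- \<eta> * \<alpha> j) * s j y)" for j
        using minus[of "\<alpha> j - y"] by (simp add: s_def exp_add[symmetric] algebra_simps)
      then have "(\<Prod>j<n. s j (y + 2 * w)) =
          (\<Prod>j<n. - exp (\<eta> * (y + w)) * (exp (- \<eta> * \<alpha> j) * s j y))"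
        by (rule prod.cong[OF refl])
      also have "\<dots> = ?M * ((\<Prod>j<n. exp (- \<eta> * \<alpha> j)) * (\<Prod>j<n. s j y))"
        by (simp only: prod.distrib prod_constant card_lessThan)
      also have "(\<Prod>j<n. exp (- \<eta> * \<alpha> j)) = exp (- \<eta> * ?S)"
        by (simp only: sum_distrib_left exp_sum[OF finite_lessThan])
      finally have P: "(\<Prod>j<n. s j (y + 2 * w)) = ?M * (exp (- \<eta> * ?S) * (\<Prod>j<n. s j y))" .
      have "?s y ^ n * H (y + 2 * w) =
          ?s (y + 2 * w) ^ n * (- exp (\<eta> * w) * exp (- \<eta> * (e - y))) * H y"
        by (rule H_shift[OF nz(1) _ minus]) simp
      also have "?s (y + 2 * w) ^ n = ?M * ?s y ^ n"
        unfolding sh by (simp only: power_mult_distrib)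
      finally have "?s y ^ n * H (y + 2 * w) =
          ?s y ^ n * (?M * (- exp (\<eta> * w) * exp (- \<eta> * (e - y))) * H y)"
        by (simp only: mult_ac)
      then have "H (y + 2 * w) = ?M * (- exp (\<eta> * w) * exp (- \<eta> * (e - y))) * H y"
        by (rule iffD1[OF mult_left_cancel, rotated]) (use nz(1) in simp)
      then have "?M * (\<Prod>j<n. s j y) * (q (y + 2 * w) * exp (- \<eta> * ?S)) =
          ?M * (\<Prod>j<n. s j y) * (- exp (\<eta> * w) * exp (- \<eta> * (e - y)) * q y)"
        unfolding q(2) P by (simp only: mult_ac)
      then have X: "q (y + 2 * w) * exp (- \<eta> * ?S) = - exp (\<eta> * w) * exp (- \<eta> * (e - y)) * q y"
        by (rule iffD1[OF mult_left_cancel, rotated]) (use nz(2) in simp)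
      have "q (y + 2 * w) = q (y + 2 * w) * exp (- \<eta> * ?S) * exp (\<eta> * ?S)"
        by (simp add: mult.assoc flip: exp_add)
      also have "\<dots> = - (exp (\<eta> * w) * exp (- \<eta> * (e - y)) * exp (\<eta> * ?S)) * q y"
        unfolding X by simp
      also have "exp (\<eta> * w) * exp (- \<eta> * (e - y)) * exp (\<eta> * ?S) = exp (- \<eta> * (e - ?S - y - w))"
        by (simp add: algebra_simps flip: exp_add)
      finally show "q (y + 2 * w) = - exp (- \<eta> * (e - ?S - y - w)) * q y" .
    qed (use z0 in auto)
    from this[of "e - ?S - (x + 2 * w)"] show ?thesis
      by (simp add: exp_minus algebra_simps exp_add exp_diff field_simps)
  qed
  obtain \<eta>1 where s1: "\<And>u. ?s (u + 2 * w1) = - exp (\<eta>1 * (u + w1)) * ?s u"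
    using wsigma_quasi_period_w1 by blast
  obtain \<eta>2 where s2: "\<And>u. ?s (u + 2 * w2) = - exp (\<eta>2 * (u + w2)) * ?s u"
    using wsigma_quasi_period_w2 by blast
  have "(\<lambda>x. q (e - ?S - x)) holomorphic_on UNIV"
    by (rule entire_compose[OF q(1)]) (intro holomorphic_intros)
  then obtain c where c: "\<And>x. q (e - ?S - x) = c * ?s x"
    by (rule quasi_periodic_eq_wsigma[OF _ q_shift[OF s1] q_shift[OF s2] s1 s2]) blast
  have "H z = c * ?s (e - ?S - z) * (\<Prod>j<n. ?s (\<alpha> j - z))" for z
    using c[of "e - ?S - z"] by (simp add: q(2) s_def)
  then show ?thesis
    unfolding H_def by blast
qed

text \<open>The factorization at \<open>z = 0\<close> and at \<open>z = \<alpha> n\<close>, with the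
  same \<open>c\<close>. At 0 every row \<open>i < n\<close> retains a positive power of
  \<open>\<sigma> 0\<close>, so only the cofactor of the last row survives.\<close>

lemma det_Suc_eq:
  fixes \<alpha> :: "nat \<Rightarrow> complex" and n :: nat
  assumes e: "wsigma w1 w2 e \<noteq> 0"
    and \<alpha>: "\<And>i. i < Suc n \<Longrightarrow> wsigma w1 w2 (\<alpha> i) \<noteq> 0"
    and distinct: "\<And>i j. i < n \<Longrightarrow> j < n \<Longrightarrow> i \<noteq> j \<Longrightarrow> wsigma w1 w2 (\<alpha> i - \<alpha> j) \<noteq> 0"
  obtains c where
    "det (mat n n (\<lambda>(i, j). phi_tilde w1 w2 e i (\<alpha> j))) =
       c * wsigma w1 w2 (e - (\<Sum>j<n. \<alpha> j)) * (\<Prod>j<n. wsigma w1 w2 (\<alpha> j))"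
    "wsigma w1 w2 (\<alpha> n) ^ n * det (mat (Suc n) (Suc n) (\<lambda>(i, j). phi_tilde w1 w2 e i (\<alpha> j))) =
       c * wsigma w1 w2 (e - (\<Sum>j<Suc n. \<alpha> j)) * (\<Prod>j<n. wsigma w1 w2 (\<alpha> j - \<alpha> n))"
proof -
  let ?s = "wsigma w1 w2" and ?\<phi> = "phi_tilde w1 w2 e"
  define A where "A = mat (Suc n) (Suc n) (\<lambda>(i, j). ?\<phi> i (\<alpha> j))"
  have \<alpha>': "?s (\<alpha> i) \<noteq> 0" if "i < n" for i
    using \<alpha> that by simp
  obtain c where c: "\<And>z. (\<Sum>i<Suc n. ?s z ^ (n - i) * phi_entire e i z * cofactor A i n) =
    c * ?s (e - (\<Sum>j<n. \<alpha> j) - z) * (\<Prod>j<n. ?s (\<alpha> j - z))"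
    using det_last_column_factorization[of e n \<alpha>, OF e \<alpha>' distinct, folded A_def] by blast
  have "mat_delete A n n = mat n n (\<lambda>(i, j). ?\<phi> i (\<alpha> j))"
    by (rule eq_matI) (auto simp: A_def mat_delete_def)
  then have "det (mat n n (\<lambda>(i, j). ?\<phi> i (\<alpha> j))) = cofactor A n n"
    by (simp add: cofactor_def)
  also have "\<dots> = (\<Sum>i<Suc n. ?s 0 ^ (n - i) * phi_entire e i 0 * cofactor A i n)"
  proof -
    have "(\<Sum>i<n. ?s 0 ^ (n - i) * phi_entire e i 0 * cofactor A i n) = 0"
      by (rule sum.neutral) auto
    then show ?thesis
      by (simp add: phi_entire_0[OF e])
  qed
  also have "\<dots> = c * ?s (e - (\<Sum>j<n. \<alpha> j)) * (\<Prod>j<n. ?s (\<alpha> j))"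
    unfolding c by simp
  finally have 1: "det (mat n n (\<lambda>(i, j). ?\<phi> i (\<alpha> j))) = \<dots>" .
  have eq: "?s (\<alpha> n) ^ (n - i) * phi_entire e i (\<alpha> n) = ?s (\<alpha> n) ^ n * ?\<phi> i (\<alpha> n)" if "i < Suc n" for i
    using that \<alpha>[of n] by (simp add: phi_entire_eq[OF e] flip: power_add mult.assoc)
  have "det A = (\<Sum>i<Suc n. A $$ (i, n) * cofactor A i n)"
    by (rule laplace_expansion_column) (auto simp: A_def)
  also have "\<dots> = (\<Sum>i<Suc n. ?\<phi> i (\<alpha> n) * cofactor A i n)"
    by (rule sum.cong[OF refl]) (simp add: A_def)
  also have "?s (\<alpha> n) ^ n * \<dots> =
      (\<Sum>i<Suc n. ?s (\<alpha> n) ^ (n - i) * phi_entire e i (\<alpha> n) * cofactor A i n)"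
    unfolding sum_distrib_left
    by (rule sum.cong[OF refl]) (simp only: eq lessThan_iff mult.assoc[symmetric])
  also have "\<dots> = c * ?s (e - (\<Sum>j<Suc n. \<alpha> j)) * (\<Prod>j<n. ?s (\<alpha> j - \<alpha> n))"
    unfolding c by (simp add: diff_diff_eq)
  finally show ?thesis
    using that[OF 1] by (simp add: A_def)
qed

text \<open>Used for points congruent modulo the lattice, where the determinant has two proportional
  columns.\<close>

lemma phi_tilde_proportional:
  assumes "wsigma w1 w2 e \<noteq> 0" "wsigma w1 w2 y \<noteq> 0" "wsigma w1 w2 (x - y) = 0"
  obtains K where "\<And>i. phi_tilde w1 w2 e i x = K * phi_tilde w1 w2 e i y"
proof -
  obtain p where p: "x - y = lattice_pt w1 w2 p"
    using assms(3) wsigma_eq_0_iff[of "x - y"] by blast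
  obtain a b where "\<And>u. wsigma w1 w2 (u + lattice_pt w1 w2 (- p)) = exp (a * u + b) * wsigma w1 w2 u"
    using wsigma_lattice_shift by blast
  then have "wsigma w1 w2 (u - (x - y)) = exp b * exp (a * u) * wsigma w1 w2 u" for u
    by (simp add: p lattice_pt_minus exp_add)
  from phi_tilde_shift[OF assms(1,2) _ this]
  have "phi_tilde w1 w2 e i x = exp b * exp (a * (e - y)) * phi_tilde w1 w2 e i y" for i
    by simp
  then show ?thesis by (rule that)
qed

lemma eventually_wsigma_nz: "\<forall>\<^sub>F x in at e. wsigma w1 w2 (x - a) \<noteq> 0"
proof -
  have "(\<lambda>x. wsigma w1 w2 (x - a)) holomorphic_on UNIV"
    by (intro holomorphic_intros)
  then have "\<forall>\<^sub>F x in at e. wsigma w1 w2 (x - a) \<noteq> 0 \<and> x \<in> UNIV"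
    by (rule non_zero_neighbour_alt[where \<beta> = "a + w1"]) (use odd_half_period_nz[of 1 0] in auto)
  then show ?thesis by simp
qed

text \<open>The induction generalises \<open>e\<close> because the step uses the hypothesis at
  nearby points \<open>x\<close>.\<close>

theorem wsigma_determinant:
  fixes \<alpha> :: "nat \<Rightarrow> complex" and n :: nat
  assumes "wsigma w1 w2 e \<noteq> 0"
    and "\<And>i. i < n \<Longrightarrow> wsigma w1 w2 (\<alpha> i) \<noteq> 0"
  shows "wsigma w1 w2 (e - (\<Sum>j<n. \<alpha> j)) *
           (\<Prod>(i, j) \<in> {(i, j). i < j \<and> j < n}. wsigma w1 w2 (\<alpha> i - \<alpha> j))
         / (wsigma w1 w2 e * (\<Prod>i<n. wsigma w1 w2 (\<alpha> i) ^ (n - 1)))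
       = det (mat n n (\<lambda>(i, j). phi_tilde w1 w2 e i (\<alpha> j)))"
  using assms
proof (induction n arbitrary: e)
  case 0
  then show ?case by simp
next
  case (Suc n)
  let ?s = "wsigma w1 w2"
  define V where "V n = (\<Prod>(i, j) \<in> {(i, j). i < j \<and> j < n}. ?s (\<alpha> i - \<alpha> j))" for n
  define S where "S = (\<Sum>j<n. \<alpha> j)"
  define P where "P = (\<Prod>j<n. ?s (\<alpha> j))"
  define L where "L x = ?s (x - (\<Sum>j<Suc n. \<alpha> j)) * V (Suc n) /
    (?s x * (\<Prod>i<Suc n. ?s (\<alpha> i) ^ n))" for x
  define R where "R x = det (mat (Suc n) (Suc n) (\<lambda>(i, j). phi_tilde w1 w2 x i (\<alpha> j)))" for x
  have fin: "finite {(i, j). i < j \<and> j < m}" for m :: nat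
    by (rule finite_subset[of _ "{..<m} \<times> {..<m}"]) auto
  have V_Suc: "V (Suc n) = V n * (\<Prod>i<n. ?s (\<alpha> i - \<alpha> n))"
  proof -
    have "{(i, j). i < j \<and> j < Suc n} = {(i, j). i < j \<and> j < n} \<union> (\<lambda>i. (i, n)) ` {..<n}"
      by auto
    then have "V (Suc n) = V n * (\<Prod>(i, j) \<in> (\<lambda>i. (i, n)) ` {..<n}. ?s (\<alpha> i - \<alpha> j))"
      unfolding V_def using fin by (simp add: prod.union_disjoint disjoint_iff image_iff)
    then show ?thesis
      by (simp add: prod.reindex inj_on_def)
  qed
  have "P \<noteq> 0" and \<alpha>n: "?s (\<alpha> n) \<noteq> 0"
    using Suc.prems(2) by (auto simp: P_def)
  \<comment> \<open>The hypothesis supplies exponent \<open>n - 1\<close> and the evaluation at 0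
    one more; \<open>n = 0\<close> is separate because of truncated subtraction.\<close>
  have pow: "(\<Prod>i<n. ?s (\<alpha> i) ^ (n - 1)) * P = P ^ n"
  proof (cases n)
    case (Suc m)
    then show ?thesis
      unfolding P_def prod_power_distrib prod.distrib[symmetric]
      by (intro prod.cong) (auto simp: mult.commute)
  qed (simp add: P_def)
  have "L e = R e"
  \<comment> \<open>Dividing by the sigma factors requires the first \<open>n\<close> points to be
    incongruent; a coincidence with \<open>\<alpha> n\<close> is covered by the
    factorization.\<close>
  proof (cases "\<exists>i j. i < n \<and> j < n \<and> i \<noteq> j \<and> ?s (\<alpha> i - \<alpha> j) = 0")
    case True
    then obtain i j where ij: "i < j" "j < n" "?s (\<alpha> i - \<alpha> j) = 0"
      by (metis linorder_neqE_nat minus_diff_eq neg_equal_0_iff_equal wsigma_minus)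
    then have "(i, j) \<in> {(i, j). i < j \<and> j < n}"
      by simp
    then have "V n = 0"
      unfolding V_def using fin[of n] ij(3) by (intro prod_zero) force+
    obtain K where "\<And>k. phi_tilde w1 w2 e k (\<alpha> i) = K * phi_tilde w1 w2 e k (\<alpha> j)"
      using phi_tilde_proportional[OF Suc.prems(1) _ ij(3)] Suc.prems(2)[of j] ij by auto
    then have "R e = 0"
      unfolding R_def using ij by (intro det_proportional_columns[of i _ j]) auto
    then show ?thesis
      using \<open>V n = 0\<close> by (simp add: L_def V_Suc)
  next
    case False
    then have distinct: "\<And>i j. i < n \<Longrightarrow> j < n \<Longrightarrow> i \<noteq> j \<Longrightarrow> ?s (\<alpha> i - \<alpha> j) \<noteq> 0"
      by blast
    \<comment> \<open>Both formulas for the smaller determinant carry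
      \<open>\<sigma> (x - S)\<close>; off its zeros it cancels, which determines
      \<open>c\<close>.\<close>
    have generic: "L x = R x" if x: "?s x \<noteq> 0" and xS: "?s (x - S) \<noteq> 0" for x
    proof -
      obtain c where c: "det (mat n n (\<lambda>(i, j). phi_tilde w1 w2 x i (\<alpha> j))) = c * ?s (x - S) * P"
        "?s (\<alpha> n) ^ n * R x = c * ?s (x - (\<Sum>j<Suc n. \<alpha> j)) * (\<Prod>j<n. ?s (\<alpha> j - \<alpha> n))"
        unfolding S_def P_def R_def
        by (rule det_Suc_eq[OF x Suc.prems(2) distinct]) blast
      have "?s (x - S) * V n / (?s x * (\<Prod>i<n. ?s (\<alpha> i) ^ (n - 1))) = c * ?s (x - S) * P"
        using Suc.IH[OF x] Suc.prems(2) c(1) by (simp add: V_def S_def)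
      moreover have "(\<Prod>i<n. ?s (\<alpha> i) ^ (n - 1)) \<noteq> 0"
        using Suc.prems(2) by auto
      ultimately have "V n = c * ?s x * ((\<Prod>i<n. ?s (\<alpha> i) ^ (n - 1)) * P)"
        using x xS by (simp add: field_simps)
      then have Vn: "V n = c * ?s x * P ^ n"
        unfolding pow .
      have "L x = ?s (x - (\<Sum>j<Suc n. \<alpha> j)) * V (Suc n) / (?s x * (P ^ n * ?s (\<alpha> n) ^ n))"
        by (simp add: L_def P_def prod_power_distrib)
      also have "\<dots> = c * ?s (x - (\<Sum>j<Suc n. \<alpha> j)) * (\<Prod>j<n. ?s (\<alpha> j - \<alpha> n)) / ?s (\<alpha> n) ^ n"
        unfolding V_Suc Vn using x \<open>P \<noteq> 0\<close> \<alpha>n by (simp add: divide_simps)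
      also have "\<dots> = R x"
        unfolding c(2)[symmetric] using \<alpha>n by simp
      finally show ?thesis .
    qed
    have "\<forall>\<^sub>F x in at e. ?s x \<noteq> 0" "\<forall>\<^sub>F x in at e. ?s (x - S) \<noteq> 0"
      using eventually_wsigma_nz[of 0] eventually_wsigma_nz by auto
    then have ev: "\<forall>\<^sub>F x in at e. L x = R x"
      by eventually_elim (rule generic)
    have cont: "isCont (\<lambda>x. ?s (x - a)) e" for a
      by (rule entire_imp_isCont) (intro holomorphic_intros)
    have "(\<Prod>i<Suc n. ?s (\<alpha> i) ^ n) \<noteq> 0"
      using Suc.prems(2) by auto
    then have "isCont L e"
      unfolding L_def using Suc.prems(1) cont[of 0]
      by (intro continuous_intros cont) auto
    moreover have "isCont R e"
      unfolding R_def by (intro isCont_det isCont_phi_tilde Suc.prems(1))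
    ultimately have "L \<midarrow>e\<rightarrow> L e" "R \<midarrow>e\<rightarrow> R e"
      by (simp_all add: isCont_def)
    then show ?thesis
      using tendsto_cong[OF ev, of "R e"] LIM_unique[of L "L e" e "R e"] by simp
  qed
  then show ?case
    by (simp add: L_def R_def V_def)
qed

end

theorem theorem9:
  fixes w1 w2 e :: complex and n :: nat and \<alpha> :: "nat \<Rightarrow> complex"
  assumes "Im (w2 / w1) > 0"
    and "n \<ge> 1"
    and "wsigma w1 w2 e \<noteq> 0"
    and "\<And>i. i < n \<Longrightarrow> wsigma w1 w2 (\<alpha> i) \<noteq> 0"
  shows "wsigma w1 w2 (e - (\<Sum>j<n. \<alpha> j)) *
           (\<Prod>(i, j) \<in> {(i, j). i < j \<and> j < n}. wsigma w1 w2 (\<alpha> i - \<alpha> j))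
         / (wsigma w1 w2 e * (\<Prod>i<n. wsigma w1 w2 (\<alpha> i) ^ (n - 1)))
       = det (mat n n (\<lambda>(i, j). phi_tilde w1 w2 e i (\<alpha> j)))"
proof -
  interpret period_lattice w1 w2
    by unfold_locales (use assms(1) in simp)
  show ?thesis
    by (rule wsigma_determinant[OF assms(3,4)])
qed

end
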